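(* Let $S$ be an inverse semigroup with zero and with set of idempotents $E$. Let $\pi\colon\mathscr{F}\to\mathcal{G}_0$ be the map from the groupoid of proper filters to the groupoid of proper germs given by $\pi(F)=[s,\xi_F]$ for any $s\in F$, where $\xi_F=\mathbf{d}(F)\cap E$. Then the restriction $\pi|_{\mathscr{U}}\colon\mathscr{U}\to\mathcal{G}_\infty$ is a topological groupoid isomorphism from the groupoid of ultrafilters to the groupoid of ultragerms, with respect to the patch topologies.
   Context: $S$ is an inverse semigroup (each $a\in S$ has a unique $a^*$ with $aa^*a=a$, $a^*aa^*=a^*$) containing $0$ with $0a=a0=0$ for all $a$. Its natural partial order is $a\le b \iff a=aa^*b$. $E=\{e\in S: ee=e\}$ is the set of idempotents, itself a commutative inverse semigroup containing $0$. For $A\subseteq S$, $A^\uparrow=\{b\in S: a\le b\text{ for some }a\in A\}$; $A^*=\{a^*:a\in A\}$; $s^\downarrow=\{b\in S: b\le s\}$; $AB=\{ab:a\in A,b\in B\}$. A filter in $S$ is a nonempty subset $F$ with $F^\uparrow=F$ that is down-directed (for $a,b\in F$ there is $c\in F$ with $c\le a,b$). It is proper if $0\notin F$; an ultrafilter is a maximal proper filter. $\mathscr{F}$ and $\mathscr{U}$ are the sets of proper filters and of ultrafilters in $S$. For filters $F,G$ put $F\cdot G=(FG)^\uparrow$. $\mathscr{F}$ is a groupoid with composable pairs $\{(F,G): F^*\cdot F=G\cdot G^*\}$, composition $(F,G)\mapsto F\cdot G$, inversion $F\mapsto F^*$; the source map is $\mathbf{d}(F)=F^*\cdot F$. $\mathscr{U}$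 is a subgroupoid of $\mathscr{F}$. The patch topology on $\mathscr{F}$ has basis $\mathscr{F}_{s:T}=\{F\in\mathscr{F}: s\in F\subseteq S\setminus T\}$, for $s\in S$ and finite $T\subseteq s^\downarrow$; the patch topology on $\mathscr{U}$ is the subspace topology. $\mathsf{F}(E)$ and $\mathsf{U}(E)$ are the sets of proper filters and of ultrafilters (maximal proper filters) in the inverse semigroup $E$. The patch topology on $\mathsf{F}(E)$ has basis $\mathsf{F}_{e:X}=\{\xi\in\mathsf{F}(E): e\in\xi\subseteq E\setminus X\}$, for $e\in E$ and finite $X\subseteq e^\downarrow$. Put $\mathsf{F}_e=\{\xi\in\mathsf{F}(E):e\in\xi\}$. Groupoid of proper germs: on $\Omega=\{(s,\xi)\in S\times\mathsf{F}(E):\xi\in\mathsf{F}_{s^*s}\}$ define the equivalence relation $(s,\xi)\sim(t,\eta)$ iff $\xi=\eta$ and there is $e\in\xi$ with $se=te$; write $[s,\xi]$ for the class of $(s,\xi)$ and $\mathcal{G}_0=\Omega/\!\sim$. For $s\in S$, $\xi\in\mathsf{F}_{s^*s}$, let $\beta_s(\xi)=\{f\in E: ses^*\le f\text{ for some }e\in\xi\}\in\mathsf{F}_{ss^*}$. Composable pairs are the $([s,\xi],[t,\eta])$ with $\xi=\beta_t(\eta)$, with composition $[s,\beta_t(\eta)][t,\eta]=[st,\eta]$ and inversion $[s,\xi]^{-1}=[s^*,\beta_s(\xi)]$. The topology on $\mathcal{G}_0$ (its patch topology) has as basis the sets $\Theta_0(s,A)=\{[s,\xi]:\xi\in A\}$,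 for $s\in S$ and $A\subseteq\mathsf{F}_{s^*s}$ open in the patch topology of $\mathsf{F}(E)$. The groupoid of ultragerms $\mathcal{G}_\infty$ is the reduction of $\mathcal{G}_0$ to $\mathsf{U}(E)$, i.e. the subgroupoid $\{[s,\xi]\in\mathcal{G}_0:\xi\in\mathsf{U}(E)\}$ (the maps $\beta_s$ preserve $\mathsf{U}(E)$), with the subspace topology. A groupoid isomorphism is a bijection $\phi\colon\mathcal{G}\to\mathcal{H}$ such that for every composable pair $(\alpha,\beta)$ in $\mathcal{G}$, $(\phi(\alpha),\phi(\beta))$ is composable in $\mathcal{H}$ and $\phi(\alpha\beta)=\phi(\alpha)\phi(\beta)$. A topological groupoid isomorphism is a groupoid isomorphism between topological groupoids that is also a homeomorphism. It is a fact that $\xi_F\in\mathsf{F}(E)$ and that $[s,\xi_F]$ does not depend on $s\in F$. *)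

theory Defs
  imports "HOL-Analysis.Product_Topology"
begin

section \<open>Inverse semigroups with zero\<close>

class inverse_semigroup_zero = semigroup_mult + mult_zero +
  assumes unique_inverse: "\<exists>!b. a * b * a = a \<and> b * a * b = b"

definition sinv :: "'a::inverse_semigroup_zero \<Rightarrow> 'a" where
  "sinv a = (THE b. a * b * a = a \<and> b * a * b = b)"

definition nat_le :: "'a::inverse_semigroup_zero \<Rightarrow> 'a \<Rightarrow> bool"  (infix "\<preceq>" 50) where
  "a \<preceq> b \<longleftrightarrow> a = a * sinv a * b"

definition idempotents :: "'a::inverse_semigroup_zero set" where
  "idempotents = {e. e * e = e}"

definition set_sinv :: "'a::inverse_semigroup_zero set \<Rightarrow> 'a set" where
  "set_sinv A = {sinv a | a. a \<in> A}"

definition set_mult :: "'a::inverse_semigroup_zero set \<Rightarrow> 'a set \<Rightarrow> 'a set" where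
  "set_mult A B = {a * b | a b. a \<in> A \<and> b \<in> B}"


section \<open>Filters, ultrafilters and the patch topology\<close>

text \<open>
  The argument \<open>S\<close> is the inverse semigroup in which filters are taken: it is only ever
  \<open>UNIV\<close> (the whole semigroup) or \<open>idempotents\<close>.  Since \<open>sinv e = e\<close> for an idempotent
  \<open>e\<close>, the natural partial order of the latter is the restriction of \<open>(\<preceq>)\<close>.
\<close>

definition up :: "'a::inverse_semigroup_zero set \<Rightarrow> 'a set \<Rightarrow> 'a set" where
  "up S A = {b \<in> S. \<exists>a\<in>A. a \<preceq> b}"

definition down :: "'a::inverse_semigroup_zero set \<Rightarrow> 'a \<Rightarrow> 'a set" where
  "down S s = {b \<in> S. b \<preceq> s}"

definition is_filter :: "'a::inverse_semigroup_zero set \<Rightarrow> 'a set \<Rightarrow> bool" where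
  "is_filter S F \<longleftrightarrow> F \<subseteq> S \<and> F \<noteq> {} \<and> up S F = F \<and>
     (\<forall>a\<in>F. \<forall>b\<in>F. \<exists>c\<in>F. c \<preceq> a \<and> c \<preceq> b)"

definition proper_filters :: "'a::inverse_semigroup_zero set \<Rightarrow> 'a set set" where
  "proper_filters S = {F. is_filter S F \<and> 0 \<notin> F}"

definition ultrafilters :: "'a::inverse_semigroup_zero set \<Rightarrow> 'a set set" where
  "ultrafilters S = {F \<in> proper_filters S. \<forall>G \<in> proper_filters S. F \<subseteq> G \<longrightarrow> G = F}"

definition patch_basic :: "'a::inverse_semigroup_zero set \<Rightarrow> 'a \<Rightarrow> 'a set \<Rightarrow> 'a set set" where
  "patch_basic S s T = {F \<in> proper_filters S. s \<in> F \<and> F \<subseteq> S - T}"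

text \<open>
  The generating families of this topology and of the topology on germs below are bases, so
  the generated topologies consist of the unions of their members.
\<close>

definition patch_topology :: "'a::inverse_semigroup_zero set \<Rightarrow> 'a set topology" where
  "patch_topology S = topology_generated_by
     {patch_basic S s T | s T. s \<in> S \<and> finite T \<and> T \<subseteq> down S s}"


section \<open>Topological groupoids\<close>

record 'g groupoid_data =
  arrows :: "'g set"
  composable :: "('g \<times> 'g) set"
  gcomp :: "'g \<Rightarrow> 'g \<Rightarrow> 'g"
  ginv :: "'g \<Rightarrow> 'g"

text \<open>
  Groupoids are axiomatised by a partial product and inversion, without explicit units; that
  \<open>(x, y)\<close> is composable iff the source of \<open>x\<close> is the range of \<open>y\<close> is a consequence.
\<close>

definition is_groupoid :: "'g groupoid_data \<Rightarrow> bool" where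
  "is_groupoid G \<longleftrightarrow>
     composable G \<subseteq> arrows G \<times> arrows G \<and>
     (\<forall>(x, y) \<in> composable G. gcomp G x y \<in> arrows G) \<and>
     (\<forall>x \<in> arrows G. ginv G x \<in> arrows G) \<and>
     (\<forall>x y z. (x, y) \<in> composable G \<longrightarrow> (y, z) \<in> composable G \<longrightarrow>
        (gcomp G x y, z) \<in> composable G \<and> (x, gcomp G y z) \<in> composable G \<and>
        gcomp G (gcomp G x y) z = gcomp G x (gcomp G y z)) \<and>
     (\<forall>x \<in> arrows G. ginv G (ginv G x) = x \<and>
        (x, ginv G x) \<in> composable G \<and> (ginv G x, x) \<in> composable G) \<and>
     (\<forall>(x, y) \<in> composable G. gcomp G (ginv G x) (gcomp G x y) = y \<and>
        gcomp G (gcomp G x y) (ginv G y) = x)"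

definition gsource :: "'g groupoid_data \<Rightarrow> 'g \<Rightarrow> 'g" where
  "gsource G x = gcomp G (ginv G x) x"

definition restrict_groupoid :: "'g groupoid_data \<Rightarrow> 'g set \<Rightarrow> 'g groupoid_data" where
  "restrict_groupoid G A =
     G\<lparr>arrows := arrows G \<inter> A, composable := composable G \<inter> A \<times> A\<rparr>"

definition topological_groupoid :: "'g groupoid_data \<Rightarrow> 'g topology \<Rightarrow> bool" where
  "topological_groupoid G X \<longleftrightarrow>
     is_groupoid G \<and> topspace X = arrows G \<and>
     continuous_map (subtopology (prod_topology X X) (composable G)) X
       (\<lambda>(x, y). gcomp G x y) \<and>
     continuous_map X X (ginv G)"

definition groupoid_isomorphism ::
  "'g groupoid_data \<Rightarrow> 'h groupoid_data \<Rightarrow> ('g \<Rightarrow> 'h) \<Rightarrow> bool" where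
  "groupoid_isomorphism G H \<phi> \<longleftrightarrow>
     bij_betw \<phi> (arrows G) (arrows H) \<and>
     (\<forall>(x, y) \<in> composable G. (\<phi> x, \<phi> y) \<in> composable H \<and>
        \<phi> (gcomp G x y) = gcomp H (\<phi> x) (\<phi> y))"

definition topological_groupoid_isomorphism ::
  "'g groupoid_data \<Rightarrow> 'g topology \<Rightarrow> 'h groupoid_data \<Rightarrow> 'h topology \<Rightarrow> ('g \<Rightarrow> 'h) \<Rightarrow> bool" where
  "topological_groupoid_isomorphism G X H Y \<phi> \<longleftrightarrow>
     topological_groupoid G X \<and> topological_groupoid H Y \<and>
     groupoid_isomorphism G H \<phi> \<and> homeomorphic_map X Y \<phi>"


section \<open>The groupoids of proper filters and of ultrafilters\<close>

definition filter_mult :: "'a::inverse_semigroup_zero set \<Rightarrow> 'a set \<Rightarrow> 'a set" where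
  "filter_mult F G = up UNIV (set_mult F G)"

definition filter_groupoid :: "'a::inverse_semigroup_zero set groupoid_data" where
  "filter_groupoid = \<lparr>
     arrows = proper_filters UNIV,
     composable = {(F, G). F \<in> proper_filters UNIV \<and> G \<in> proper_filters UNIV \<and>
       filter_mult (set_sinv F) F = filter_mult G (set_sinv G)},
     gcomp = filter_mult,
     ginv = set_sinv\<rparr>"

definition ultrafilter_groupoid :: "'a::inverse_semigroup_zero set groupoid_data" where
  "ultrafilter_groupoid = restrict_groupoid filter_groupoid (ultrafilters UNIV)"

definition ultrafilter_topology :: "'a::inverse_semigroup_zero set topology" where
  "ultrafilter_topology = subtopology (patch_topology UNIV) (ultrafilters UNIV)"


section \<open>The groupoids of proper germs and of ultragerms\<close>

definition FE :: "'a::inverse_semigroup_zero \<Rightarrow> 'a set set" where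
  "FE e = {\<xi> \<in> proper_filters idempotents. e \<in> \<xi>}"

definition germ_pairs :: "('a::inverse_semigroup_zero \<times> 'a set) set" where
  "germ_pairs = {(s, \<xi>). \<xi> \<in> FE (sinv s * s)}"

definition germ_rel ::
  "(('a::inverse_semigroup_zero \<times> 'a set) \<times> ('a \<times> 'a set)) set" where
  "germ_rel = {((s, \<xi>), (t, \<eta>)). (s, \<xi>) \<in> germ_pairs \<and> (t, \<eta>) \<in> germ_pairs \<and>
     \<xi> = \<eta> \<and> (\<exists>e\<in>\<xi>. s * e = t * e)}"

type_synonym 'a germ = "('a \<times> 'a set) set"

definition germ :: "'a::inverse_semigroup_zero \<Rightarrow> 'a set \<Rightarrow> 'a germ" where
  "germ s \<xi> = germ_rel `` {(s, \<xi>)}"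

definition beta :: "'a::inverse_semigroup_zero \<Rightarrow> 'a set \<Rightarrow> 'a set" where
  "beta s \<xi> = {f \<in> idempotents. \<exists>e\<in>\<xi>. s * e * sinv s \<preceq> f}"

text \<open>
  Composition and inversion of germs are given by formulas on representatives, so the
  descriptions below denote the common value of these formulas.
\<close>

definition germ_mult :: "'a::inverse_semigroup_zero germ \<Rightarrow> 'a germ \<Rightarrow> 'a germ" where
  "germ_mult g h = (THE k. \<exists>s t \<eta>. (s, beta t \<eta>) \<in> germ_pairs \<and> (t, \<eta>) \<in> germ_pairs \<and>
     g = germ s (beta t \<eta>) \<and> h = germ t \<eta> \<and> k = germ (s * t) \<eta>)"

definition germ_inv :: "'a::inverse_semigroup_zero germ \<Rightarrow> 'a germ" where
  "germ_inv g = (THE k. \<exists>s \<xi>. (s, \<xi>) \<in> germ_pairs \<and>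
     g = germ s \<xi> \<and> k = germ (sinv s) (beta s \<xi>))"

definition germ_groupoid :: "'a::inverse_semigroup_zero germ groupoid_data" where
  "germ_groupoid = \<lparr>
     arrows = germ_pairs // germ_rel,
     composable = {(germ s \<xi>, germ t \<eta>) | s \<xi> t \<eta>.
       (s, \<xi>) \<in> germ_pairs \<and> (t, \<eta>) \<in> germ_pairs \<and> \<xi> = beta t \<eta>},
     gcomp = germ_mult,
     ginv = germ_inv\<rparr>"

definition Theta :: "'a::inverse_semigroup_zero \<Rightarrow> 'a set set \<Rightarrow> 'a germ set" where
  "Theta s A = {germ s \<xi> | \<xi>. \<xi> \<in> A}"

definition germ_topology :: "'a::inverse_semigroup_zero germ topology" where
  "germ_topology = topology_generated_by
     {Theta s A | s A. A \<subseteq> FE (sinv s * s) \<and> openin (patch_topology idempotents) A}"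

definition ultragerms :: "'a::inverse_semigroup_zero germ set" where
  "ultragerms = {germ s \<xi> | s \<xi>. (s, \<xi>) \<in> germ_pairs \<and> \<xi> \<in> ultrafilters idempotents}"

definition ultragerm_groupoid :: "'a::inverse_semigroup_zero germ groupoid_data" where
  "ultragerm_groupoid = restrict_groupoid germ_groupoid ultragerms"

definition ultragerm_topology :: "'a::inverse_semigroup_zero germ topology" where
  "ultragerm_topology = subtopology germ_topology ultragerms"


section \<open>The comparison map\<close>

definition filter_idem :: "'a::inverse_semigroup_zero set \<Rightarrow> 'a set" where
  "filter_idem F = gsource filter_groupoid F \<inter> idempotents"

definition germ_map :: "'a::inverse_semigroup_zero set \<Rightarrow> 'a germ" where
  "germ_map F = (THE g. \<exists>s\<in>F. g = germ s (filter_idem F))"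

end

(* A proper filter F is recovered from any s in F together with xi_F as the upward closure of
   s xi_F, so germs (s, xi) and proper filters are two encodings of the same data: two pairs define
   the same germ iff they generate the same filter. Composability of F and G becomes
   xi_F = beta_t(xi_G), and as xi_(F G) = xi_G, the product of germs is forced to be the product of
   filters.
   For the patch topologies everything reduces to membership tests relative to a known element: for
   t in G and composable F, G one has x in F G iff x t* in F (continuity of the product); for s in F
   one has e in xi_F iff s e in F (continuity of F |-> xi_F); and for t <= s in F one has
   t in F iff t* t in xi_F (continuity of the inverse map).
   Finally F is an ultrafilter iff xi_F is one, so everything restricts to ultrafilters. *)

theory Submission
  imports Defs
begin

section \<open>Inverse semigroups\<close>

text \<open>The claim includes that both sides are topological groupoids. On germs, product and
  inverse are definite descriptions over representatives, and checking the groupoid laws there would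
  mean matching representatives at every step. Hence the laws and the continuity of the operations
  are proved for filters, where products are upward closures and directedness does the work; the
  germ side inherits them along the bijection. That the germ operations are well defined is a
  by-product: every pair representing the germ of F gives back F. Recovering F from s and xi_F rests
  on one identity: \<open>c \<preceq> s\<close> forces \<open>c = s * (sinv c * c)\<close>, and
  \<open>sinv c * c\<close> is in xi_F whenever c is in F. A basic patch set excludes only elements
  below the included one. The maps behind the membership tests (multiplication by a fixed element,
  inversion, passage to \<open>sinv t * t\<close>) are monotone, so they carry admissible excluded
  sets to admissible ones. The auxiliary element of a test varies with the filter, which is why
  preimages appear as unions over all its values.\<close>

lemma inverse_laws:
  fixes a :: "'a::inverse_semigroup_zero"
  shows mult_sinv_mult: "a * sinv a * a = a"
    and sinv_mult_sinv: "sinv a * a * sinv a = sinv a"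
  using theI'[OF unique_inverse[of a]] unfolding sinv_def by auto

text \<open>Right-nested forms, needed because \<open>mult.assoc\<close> as a rewrite rule destroys
  the left-nested patterns of the two laws.\<close>

lemma inverse_laws_assoc:
  fixes a :: "'a::inverse_semigroup_zero"
  shows "a * (sinv a * a) = a" "a * (sinv a * (a * x)) = a * x"
    and "sinv a * (a * sinv a) = sinv a" "sinv a * (a * (sinv a * x)) = sinv a * x"
  using mult_sinv_mult[of a] sinv_mult_sinv[of a] by (metis mult.assoc)+

lemma sinv_unique:
  fixes a :: "'a::inverse_semigroup_zero"
  assumes "a * b * a = a" "b * a * b = b"
  shows "sinv a = b"
  using assms unique_inverse[of a] mult_sinv_mult[of a] sinv_mult_sinv[of a] by blast

lemma sinv_sinv [simp]: "sinv (sinv a) = (a::'a::inverse_semigroup_zero)"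
  by (rule sinv_unique) (rule sinv_mult_sinv mult_sinv_mult)+

lemma idempotent_mult_self: "e \<in> idempotents \<Longrightarrow> e * e = e"
  by (simp add: idempotents_def)

lemma idempotent_mult_self_assoc: "e \<in> idempotents \<Longrightarrow> e * (e * x) = e * x"
  by (simp add: idempotent_mult_self mult.assoc[symmetric])

lemma sinv_idempotent: "e \<in> idempotents \<Longrightarrow> sinv e = e"
  by (rule sinv_unique) (simp_all add: idempotent_mult_self)

lemma zero_idempotent: "0 \<in> idempotents"
  by (simp add: idempotents_def)

text \<open>If x is the inverse of \<open>e * f\<close>, then \<open>f * x * e\<close> is an inverse
  of \<open>e * f\<close> too, so x = f x e by uniqueness. This makes x idempotent, hence its own
  inverse, and therefore equal to \<open>e * f\<close>.\<close>

lemma idempotent_mult: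
  assumes e: "e \<in> idempotents" and f: "f \<in> idempotents"
  shows "e * f \<in> idempotents"
proof -
  define x where "x = sinv (e * f)"
  have 1: "e * f * x * (e * f) = e * f" and 2: "x * (e * f) * x = x"
    unfolding x_def by (rule mult_sinv_mult sinv_mult_sinv)+
  have "x = f * x * e"
    unfolding x_def
  proof (rule sinv_unique)
    show "e * f * (f * sinv (e * f) * e) * (e * f) = e * f"
      using 1 e f unfolding x_def[symmetric]
      by (simp add: mult.assoc idempotent_mult_self_assoc)
    have "f * x * e * (e * f) * (f * x * e) = f * (x * (e * f) * x) * e"
      using e f by (simp add: mult.assoc idempotent_mult_self_assoc)
    then show "f * sinv (e * f) * e * (e * f) * (f * sinv (e * f) * e) = f * sinv (e * f) * e"
      using 2 unfolding x_def[symmetric] by simp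
  qed
  \<comment> \<open>Both factors are replaced at once; as a rewrite rule the equation would loop,
    because x occurs on its right-hand side.\<close>
  from this this have "x * x = f * x * e * (f * x * e)"
    by (rule arg_cong2)
  also have "\<dots> = f * (x * (e * f) * x) * e"
    by (simp add: mult.assoc)
  finally have "x * x = f * (x * (e * f) * x) * e" .
  with 2 \<open>x = f * x * e\<close> have "x * x = x"
    by simp
  then have "x \<in> idempotents"
    by (simp add: idempotents_def)
  moreover from this have "x = e * f"
    using sinv_idempotent[of x] unfolding x_def by simp
  ultimately show ?thesis by simp
qed

text \<open>Since \<open>e * f\<close> and \<open>f * e\<close> are both idempotent,
  \<open>f * e\<close> is an inverse of \<open>e * f\<close>; but an idempotent is its own
  inverse.\<close>

lemma idempotent_commute:
  assumes e: "e \<in> idempotents" and f: "f \<in> idempotents"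
  shows "e * f = f * e"
proof -
  note ef = idempotent_mult_self[OF idempotent_mult[OF e f]]
  note fe = idempotent_mult_self[OF idempotent_mult[OF f e]]
  have "sinv (e * f) = f * e"
  proof (rule sinv_unique)
    show "e * f * (f * e) * (e * f) = e * f"
      using ef e f by (simp add: mult.assoc idempotent_mult_self_assoc)
    show "f * e * (e * f) * (f * e) = f * e"
      using fe e f by (simp add: mult.assoc idempotent_mult_self_assoc)
  qed
  then show ?thesis
    by (simp add: sinv_idempotent[OF idempotent_mult[OF e f]])
qed

lemma idempotent_left_commute:
  "e \<in> idempotents \<Longrightarrow> f \<in> idempotents \<Longrightarrow> e * (f * x) = f * (e * x)"
  by (metis idempotent_commute mult.assoc)

lemma mult_sinv_idempotent [simp]: "a * sinv a \<in> idempotents"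
  by (simp add: idempotents_def mult.assoc inverse_laws_assoc)

lemma sinv_mult_idempotent [simp]: "sinv a * a \<in> idempotents"
  by (simp add: idempotents_def mult.assoc inverse_laws_assoc)

text \<open>Commuting the idempotents \<open>b * sinv b\<close> and \<open>sinv a * a\<close> brings
  each element next to its own inverse.\<close>

lemma sinv_mult: "sinv (a * b) = sinv b * sinv a"
proof (rule sinv_unique)
  have c: "b * sinv b * (sinv a * a) = sinv a * a * (b * sinv b)"
    by (rule idempotent_commute) simp_all
  have "a * b * (sinv b * sinv a) * (a * b) = a * (b * sinv b * (sinv a * a)) * b"
    by (simp add: mult.assoc)
  also have "\<dots> = a * b"
    unfolding c by (simp add: mult.assoc inverse_laws_assoc)
  finally show "a * b * (sinv b * sinv a) * (a * b) = a * b" .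
  have "sinv b * sinv a * (a * b) * (sinv b * sinv a)
      = sinv b * (sinv a * a * (b * sinv b)) * sinv a"
    by (simp add: mult.assoc)
  also have "\<dots> = sinv b * sinv a"
    unfolding c[symmetric] by (simp add: mult.assoc inverse_laws_assoc)
  finally show "sinv b * sinv a * (a * b) * (sinv b * sinv a) = sinv b * sinv a" .
qed


section \<open>The natural partial order\<close>

lemma idempotent_mult_nat_le:
  assumes "e \<in> idempotents"
  shows "e * a \<preceq> a"
proof -
  have "e * a * sinv (e * a) * a = e * (a * sinv a * e) * a"
    using assms by (simp add: sinv_mult sinv_idempotent mult.assoc)
  also have "\<dots> = e * (e * (a * sinv a)) * a"
    using assms by (simp add: idempotent_commute[of "a * sinv a" e])
  also have "\<dots> = e * a"
    using assms by (simp add: mult.assoc idempotent_mult_self_assoc inverse_laws_assoc)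
  finally show ?thesis
    by (simp add: nat_le_def)
qed

lemma mult_idempotent_nat_le:
  assumes "e \<in> idempotents"
  shows "a * e \<preceq> a"
proof -
  have "a * e * sinv (a * e) * a = a * (e * (sinv a * a))"
    using assms by (simp add: sinv_mult sinv_idempotent mult.assoc idempotent_mult_self_assoc)
  also have "\<dots> = a * e"
    using assms by (simp add: idempotent_commute[of e] mult.assoc inverse_laws_assoc)
  finally show ?thesis
    by (simp add: nat_le_def)
qed

lemma nat_le_left: "a \<preceq> b \<Longrightarrow> a = a * sinv a * b"
  by (simp add: nat_le_def)

text \<open>The order is defined with an idempotent factor on the left; this moves it to the right.
  Inverting \<open>a = a * sinv a * b\<close> gives \<open>sinv a = sinv b * (a * sinv a)\<close>,
  and commuting idempotents do the rest. Whatever lies below s is thus s times an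
  idempotent.\<close>

lemma nat_le_right:
  assumes "a \<preceq> b"
  shows "a = b * (sinv a * a)"
proof -
  have a: "a = a * sinv a * b" by (rule nat_le_left) fact
  then have s: "sinv a = sinv b * (a * sinv a)"
    by (metis sinv_mult sinv_idempotent mult_sinv_idempotent)
  have "b * (sinv a * a) = b * sinv b * a"
    by (subst s) (simp add: mult.assoc inverse_laws_assoc)
  also have "\<dots> = b * sinv b * (a * sinv a * b)"
    using a by simp
  also have "\<dots> = a * sinv a * (b * sinv b * b)"
    using idempotent_left_commute[of "b * sinv b" "a * sinv a" b] by (simp add: mult.assoc)
  also have "\<dots> = a"
    using a by (simp add: mult_sinv_mult)
  finally show ?thesis by simp
qed

lemma nat_le_refl [simp]: "a \<preceq> a"
  by (simp add: nat_le_def mult_sinv_mult)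

lemma nat_le_trans:
  assumes "a \<preceq> b" "b \<preceq> c"
  shows "a \<preceq> c"
proof -
  have "a = a * sinv a * (b * sinv b) * c"
    using nat_le_left[OF assms(1)] nat_le_left[OF assms(2)] by (metis mult.assoc)
  then show ?thesis
    by (metis idempotent_mult_nat_le idempotent_mult mult_sinv_idempotent)
qed

lemma nat_le_sinv: "a \<preceq> b \<Longrightarrow> sinv a \<preceq> sinv b"
  by (metis mult_idempotent_nat_le nat_le_left sinv_mult sinv_idempotent mult_sinv_idempotent)

lemma nat_le_mult:
  assumes "a \<preceq> b" "c \<preceq> d"
  shows "a * c \<preceq> b * d"
proof (rule nat_le_trans)
  have "a * c = a * sinv a * (b * c)"
    using nat_le_left[OF assms(1)] by (metis mult.assoc)
  then show "a * c \<preceq> b * c"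
    by (metis idempotent_mult_nat_le mult_sinv_idempotent)
  have "b * c = b * d * (sinv c * c)"
    using nat_le_right[OF assms(2)] by (metis mult.assoc)
  then show "b * c \<preceq> b * d"
    by (metis mult_idempotent_nat_le sinv_mult_idempotent)
qed

lemma nat_le_zero: "a \<preceq> 0 \<longleftrightarrow> a = 0"
  by (auto dest: nat_le_left)

lemma sinv_mult_eq_zero: "sinv a * a = 0 \<longleftrightarrow> a = (0::'a::inverse_semigroup_zero)"
  using inverse_laws_assoc(1)[of a] by auto


section \<open>Filters\<close>

text \<open>For \<open>F \<subseteq> S\<close> reflexivity of the order already gives
  \<open>F \<subseteq> up S F\<close>, so the fixed-point condition amounts to upward closure within
  \<open>S\<close>.\<close>

lemma is_filter_iff:
  "is_filter S F \<longleftrightarrow> F \<subseteq> S \<and> F \<noteq> {} \<and> (\<forall>a\<in>F. \<forall>b\<in>S. a \<preceq> b \<longrightarrow> b \<in> F) \<and>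
     (\<forall>a\<in>F. \<forall>b\<in>F. \<exists>c\<in>F. c \<preceq> a \<and> c \<preceq> b)"
  unfolding is_filter_def up_def by (auto intro: nat_le_refl)

lemma filter_up: "is_filter UNIV F \<Longrightarrow> a \<in> F \<Longrightarrow> a \<preceq> b \<Longrightarrow> b \<in> F"
  by (simp add: is_filter_iff)

lemma filter_directed:
  assumes "is_filter S F" "a \<in> F" "b \<in> F"
  obtains c where "c \<in> F" "c \<preceq> a" "c \<preceq> b"
  using assms unfolding is_filter_iff by blast

lemma filter_nonempty:
  assumes "is_filter S F"
  obtains a where "a \<in> F"
  using assms by (auto simp: is_filter_iff)

lemma filter_carrier: "is_filter S F \<Longrightarrow> a \<in> F \<Longrightarrow> a \<in> S"
  by (auto simp: is_filter_iff)

text \<open>A common lower bound g of e and f in the filter satisfies \<open>g = g * g\<close>,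
  which lies below \<open>e * f\<close>.\<close>

lemma filter_idempotents_mult:
  assumes \<xi>: "is_filter idempotents \<xi>" and e: "e \<in> \<xi>" and f: "f \<in> \<xi>"
  shows "e * f \<in> \<xi>"
proof -
  obtain g where g: "g \<in> \<xi>" "g \<preceq> e" "g \<preceq> f"
    using filter_directed[OF \<xi> e f] .
  have "g * g \<preceq> e * f"
    using g by (blast intro: nat_le_mult)
  moreover have "g * g = g"
    using filter_carrier[OF \<xi> g(1)] by (rule idempotent_mult_self)
  moreover have "e * f \<in> idempotents"
    using filter_carrier[OF \<xi>] e f by (blast intro: idempotent_mult)
  ultimately show ?thesis
    using \<xi> g(1) by (auto simp: is_filter_iff)
qed

section \<open>Products and inverses of filters\<close>

lemma filter_mult_iff: "x \<in> filter_mult A B \<longleftrightarrow> (\<exists>a\<in>A. \<exists>b\<in>B. a * b \<preceq> x)"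
  by (auto simp: filter_mult_def up_def set_mult_def)

lemma set_sinv_iff: "x \<in> set_sinv A \<longleftrightarrow> sinv x \<in> A"
  by (auto simp: set_sinv_def) (metis sinv_sinv)

lemma set_sinv_set_sinv [simp]: "set_sinv (set_sinv A) = A"
  by (auto simp: set_sinv_iff)

lemma filter_multI: "a \<in> A \<Longrightarrow> b \<in> B \<Longrightarrow> a * b \<preceq> x \<Longrightarrow> x \<in> filter_mult A B"
  by (auto simp: filter_mult_iff)

lemma filter_multE:
  assumes "x \<in> filter_mult A B"
  obtains a b where "a \<in> A" "b \<in> B" "a * b \<preceq> x"
  using assms by (auto simp: filter_mult_iff)

text \<open>Both sides are the upward closure of the set of triple products.\<close>

lemma filter_mult_assoc: "filter_mult (filter_mult A B) C = filter_mult A (filter_mult B C)"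
proof (intro set_eqI iffI)
  fix x
  assume "x \<in> filter_mult (filter_mult A B) C"
  then obtain a b c y where abc: "a \<in> A" "b \<in> B" "c \<in> C" and y: "a * b \<preceq> y" "y * c \<preceq> x"
    by (elim filter_multE)
  have "a * (b * c) \<preceq> x"
    using nat_le_trans[OF nat_le_mult[OF y(1) nat_le_refl] y(2)] by (simp add: mult.assoc)
  with abc show "x \<in> filter_mult A (filter_mult B C)"
    by (blast intro: filter_multI nat_le_refl)
next
  fix x
  assume "x \<in> filter_mult A (filter_mult B C)"
  then obtain a b c y where abc: "a \<in> A" "b \<in> B" "c \<in> C" and y: "b * c \<preceq> y" "a * y \<preceq> x"
    by (elim filter_multE)
  have "a * b * c \<preceq> x"
    using nat_le_trans[OF nat_le_mult[OF nat_le_refl y(1)] y(2)] by (simp add: mult.assoc)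
  with abc show "x \<in> filter_mult (filter_mult A B) C"
    by (blast intro: filter_multI nat_le_refl)
qed

lemma set_sinv_filter_mult_subset:
  "set_sinv (filter_mult A B) \<subseteq> filter_mult (set_sinv B) (set_sinv A)"
proof
  fix x
  assume "x \<in> set_sinv (filter_mult A B)"
  then obtain a b where ab: "a \<in> A" "b \<in> B" "a * b \<preceq> sinv x"
    by (auto simp: set_sinv_iff elim: filter_multE)
  have "sinv b * sinv a \<preceq> x"
    using nat_le_sinv[OF ab(3)] by (simp add: sinv_mult)
  then show "x \<in> filter_mult (set_sinv B) (set_sinv A)"
    using ab by (intro filter_multI[of "sinv b" _ "sinv a"]) (simp_all add: set_sinv_iff)
qed

text \<open>Inversion is an involution, so applying the known inclusion to the inverted sets yields
  the opposite one.\<close>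

lemma set_sinv_filter_mult: "set_sinv (filter_mult A B) = filter_mult (set_sinv B) (set_sinv A)"
proof
  show "filter_mult (set_sinv B) (set_sinv A) \<subseteq> set_sinv (filter_mult A B)"
  proof
    fix x
    assume "x \<in> filter_mult (set_sinv B) (set_sinv A)"
    then have "sinv x \<in> set_sinv (filter_mult (set_sinv B) (set_sinv A))"
      by (simp add: set_sinv_iff)
    then show "x \<in> set_sinv (filter_mult A B)"
      using set_sinv_filter_mult_subset[of "set_sinv B" "set_sinv A"]
      by (simp add: subset_iff set_sinv_iff)
  qed
qed (rule set_sinv_filter_mult_subset)

lemma is_filter_set_sinv:
  assumes F: "is_filter UNIV F"
  shows "is_filter UNIV (set_sinv F)"
  unfolding is_filter_iff
proof (intro conjI ballI impI)
  show "set_sinv F \<noteq> {}"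
    using F by (auto simp: is_filter_iff set_sinv_def)
  fix a b
  assume a: "a \<in> set_sinv F"
  { assume "a \<preceq> b"
    then show "b \<in> set_sinv F"
      using filter_up[OF F] a nat_le_sinv by (auto simp: set_sinv_iff) }
  assume b: "b \<in> set_sinv F"
  obtain c where "c \<in> F" "c \<preceq> sinv a" "c \<preceq> sinv b"
    using filter_directed[OF F] a b by (metis set_sinv_iff)
  then show "\<exists>c\<in>set_sinv F. c \<preceq> a \<and> c \<preceq> b"
    by (metis nat_le_sinv set_sinv_iff sinv_sinv)
qed simp

lemma is_filter_filter_mult:
  assumes F: "is_filter UNIV F" and G: "is_filter UNIV G"
  shows "is_filter UNIV (filter_mult F G)"
  unfolding is_filter_iff
proof (intro conjI ballI impI)
  show "filter_mult F G \<noteq> {}"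
  proof -
    obtain a b where "a \<in> F" "b \<in> G"
      using filter_nonempty[OF F] filter_nonempty[OF G] by metis
    then have "a * b \<in> filter_mult F G"
      using nat_le_refl by (rule filter_multI)
    then show ?thesis by blast
  qed
  fix x y
  assume x: "x \<in> filter_mult F G"
  { assume "x \<preceq> y"
    then show "y \<in> filter_mult F G"
      using x nat_le_trans by (fastforce simp: filter_mult_iff) }
  assume y: "y \<in> filter_mult F G"
  obtain a b a' b' where ab: "a \<in> F" "b \<in> G" "a * b \<preceq> x" "a' \<in> F" "b' \<in> G" "a' * b' \<preceq> y"
    using x y by (auto simp: filter_mult_iff)
  obtain c where c: "c \<in> F" "c \<preceq> a" "c \<preceq> a'"
    using filter_directed[OF F] ab by metis
  obtain d where d: "d \<in> G" "d \<preceq> b" "d \<preceq> b'"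
    using filter_directed[OF G] ab by metis
  have "c * d \<preceq> x" "c * d \<preceq> y"
    using ab c d by (meson nat_le_mult nat_le_trans)+
  moreover have "c * d \<in> filter_mult F G"
    using c d by (auto simp: filter_mult_iff intro: nat_le_refl)
  ultimately show "\<exists>c\<in>filter_mult F G. c \<preceq> x \<and> c \<preceq> y" by blast
qed simp

text \<open>Directedness replaces the three elements of F in a product by one d below all of them,
  and \<open>d * (sinv d * d) = d\<close>. Conversely each x in F is itself such a triple
  product.\<close>

lemma filter_mult_set_sinv_cancel:
  assumes F: "is_filter UNIV F"
  shows "filter_mult F (filter_mult (set_sinv F) F) = F"
proof (intro set_eqI iffI)
  fix x
  assume "x \<in> filter_mult F (filter_mult (set_sinv F) F)"
  then obtain a b c y where abc: "a \<in> F" "sinv b \<in> F" "c \<in> F" and y: "b * c \<preceq> y" "a * y \<preceq> x"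
    by (auto simp: set_sinv_iff elim!: filter_multE)
  have le: "a * (b * c) \<preceq> x"
    using nat_le_trans[OF nat_le_mult[OF nat_le_refl y(1)] y(2)] .
  obtain d' where d': "d' \<in> F" "d' \<preceq> a" "d' \<preceq> sinv b"
    using filter_directed[OF F abc(1,2)] .
  obtain d where d: "d \<in> F" "d \<preceq> d'" "d \<preceq> c"
    using filter_directed[OF F d'(1) abc(3)] .
  have "sinv d \<preceq> b"
    using nat_le_sinv[OF nat_le_trans[OF d(2) d'(3)]] by simp
  then have "d * (sinv d * d) \<preceq> a * (b * c)"
    using d d' by (blast intro: nat_le_mult nat_le_trans)
  then have "d \<preceq> x"
    using nat_le_trans[OF _ le] by (simp add: inverse_laws_assoc)
  with d(1) show "x \<in> F"
    using F filter_up by blast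
next
  fix x
  assume "x \<in> F"
  moreover from this have "sinv x \<in> set_sinv F"
    by (simp add: set_sinv_iff)
  ultimately have "x * (sinv x * x) \<in> filter_mult F (filter_mult (set_sinv F) F)"
    by (blast intro: filter_multI nat_le_refl)
  then show "x \<in> filter_mult F (filter_mult (set_sinv F) F)"
    by (simp add: inverse_laws_assoc)
qed


section \<open>The groupoid of proper filters\<close>

lemma proper_filtersD:
  assumes "F \<in> proper_filters S"
  shows "is_filter S F" "0 \<notin> F"
  using assms by (auto simp: proper_filters_def)

lemma set_sinv_proper:
  assumes "F \<in> proper_filters UNIV"
  shows "set_sinv F \<in> proper_filters UNIV"
  using assms is_filter_set_sinv[of F]
  by (simp add: proper_filters_def set_sinv_iff sinv_idempotent zero_idempotent)

text \<open>Composability is what keeps 0 out: if 0 were in the product F G, then multiplying by the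
  inverse filter of F would put 0 into G, because the source of F is the range of G and acts on G as
  a unit.\<close>

lemma filter_mult_proper:
  assumes F: "F \<in> proper_filters UNIV" and G: "G \<in> proper_filters UNIV"
    and eq: "filter_mult (set_sinv F) F = filter_mult G (set_sinv G)"
  shows "filter_mult F G \<in> proper_filters UNIV"
proof -
  note FG = proper_filtersD(1)[OF F] proper_filtersD(1)[OF G]
  have "0 \<notin> filter_mult F G"
  proof
    assume 0: "0 \<in> filter_mult F G"
    obtain a where "a \<in> F"
      using filter_nonempty FG(1) .
    then have "sinv a \<in> set_sinv F"
      by (simp add: set_sinv_iff)
    then have "0 \<in> filter_mult (set_sinv F) (filter_mult F G)"
      using 0 by (rule filter_multI) simp
    also have "\<dots> = filter_mult (filter_mult (set_sinv F) F) G"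
      by (simp add: filter_mult_assoc)
    also have "\<dots> = G"
      unfolding eq using filter_mult_set_sinv_cancel[OF FG(2)] by (simp add: filter_mult_assoc)
    finally show False
      using proper_filtersD(2)[OF G] by simp
  qed
  then show ?thesis
    using is_filter_filter_mult[OF FG] by (simp add: proper_filters_def)
qed

text \<open>After reassociation the source of F can be exchanged for the range of G, and each of
  them is absorbed by its own filter.\<close>

lemma filter_mult_cancel:
  assumes F: "is_filter UNIV F" and G: "is_filter UNIV G"
    and eq: "filter_mult (set_sinv F) F = filter_mult G (set_sinv G)"
  shows filter_mult_cancel_left: "filter_mult (set_sinv F) (filter_mult F G) = G"
    and filter_mult_cancel_right: "filter_mult (filter_mult F G) (set_sinv G) = F"
proof -
  show "filter_mult (set_sinv F) (filter_mult F G) = G"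
    using filter_mult_set_sinv_cancel[OF G] by (simp add: filter_mult_assoc[symmetric] eq)
  show "filter_mult (filter_mult F G) (set_sinv G) = F"
    using filter_mult_set_sinv_cancel[OF F] by (simp add: filter_mult_assoc eq[symmetric])
qed

lemma filter_mult_source:
  assumes F: "is_filter UNIV F" and G: "is_filter UNIV G"
    and eq: "filter_mult (set_sinv F) F = filter_mult G (set_sinv G)"
  shows "filter_mult (set_sinv (filter_mult F G)) (filter_mult F G) = filter_mult (set_sinv G) G"
  using filter_mult_cancel_left[OF assms]
  by (simp add: set_sinv_filter_mult filter_mult_assoc)

lemma filter_mult_range:
  assumes F: "is_filter UNIV F" and G: "is_filter UNIV G"
    and eq: "filter_mult (set_sinv F) F = filter_mult G (set_sinv G)"
  shows "filter_mult (filter_mult F G) (set_sinv (filter_mult F G)) = filter_mult F (set_sinv F)"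
  using filter_mult_cancel_right[OF assms]
  by (simp add: set_sinv_filter_mult filter_mult_assoc[symmetric])

lemma composable_filter_groupoid:
  "(F, G) \<in> composable filter_groupoid \<longleftrightarrow> F \<in> proper_filters UNIV \<and> G \<in> proper_filters UNIV \<and>
     filter_mult (set_sinv F) F = filter_mult G (set_sinv G)"
  by (simp add: filter_groupoid_def)

lemma filter_groupoid_simps [simp]:
  "arrows filter_groupoid = proper_filters UNIV"
  "gcomp filter_groupoid = filter_mult"
  "ginv filter_groupoid = set_sinv"
  by (simp_all add: filter_groupoid_def)

lemma is_groupoid_filter_groupoid: "is_groupoid filter_groupoid"
  unfolding is_groupoid_def filter_groupoid_simps
proof (intro conjI)
  show "composable filter_groupoid \<subseteq> proper_filters UNIV \<times> proper_filters UNIV"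
    by (auto simp: composable_filter_groupoid)
  show "\<forall>(F, G)\<in>composable filter_groupoid. filter_mult F G \<in> proper_filters UNIV"
    by (auto simp: composable_filter_groupoid filter_mult_proper)
  show "\<forall>F\<in>proper_filters UNIV. set_sinv F \<in> proper_filters UNIV"
    by (simp add: set_sinv_proper)
  show "\<forall>F G H. (F, G) \<in> composable filter_groupoid \<longrightarrow> (G, H) \<in> composable filter_groupoid \<longrightarrow>
      (filter_mult F G, H) \<in> composable filter_groupoid \<and>
      (F, filter_mult G H) \<in> composable filter_groupoid \<and>
      filter_mult (filter_mult F G) H = filter_mult F (filter_mult G H)"
    \<comment> \<open>Products are normalised to the right here, so the source and range laws must
      be supplied in that form as well.\<close>
    by (auto simp: composable_filter_groupoid filter_mult_proper filter_mult_assoc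
        filter_mult_source[OF proper_filtersD(1) proper_filtersD(1), unfolded filter_mult_assoc]
        filter_mult_range[OF proper_filtersD(1) proper_filtersD(1), unfolded filter_mult_assoc])
  show "\<forall>F\<in>proper_filters UNIV. set_sinv (set_sinv F) = F \<and>
      (F, set_sinv F) \<in> composable filter_groupoid \<and> (set_sinv F, F) \<in> composable filter_groupoid"
    by (simp add: composable_filter_groupoid set_sinv_proper)
  show "\<forall>(F, G)\<in>composable filter_groupoid. filter_mult (set_sinv F) (filter_mult F G) = G \<and>
      filter_mult (filter_mult F G) (set_sinv G) = F"
    by (clarsimp simp: composable_filter_groupoid)
      (simp add: filter_mult_cancel_left filter_mult_cancel_right proper_filtersD(1))
qed


section \<open>Filters as germs\<close>

text \<open>The inverse of the comparison map sends the germ of \<open>s\<close> at \<open>\<xi>\<close> to this filter.\<close>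

definition germ_filter :: "'a::inverse_semigroup_zero \<Rightarrow> 'a set \<Rightarrow> 'a set" where
  "germ_filter s \<xi> = {x. \<exists>e\<in>\<xi>. s * e \<preceq> x}"

lemma germ_filterI: "e \<in> \<xi> \<Longrightarrow> s * e \<preceq> x \<Longrightarrow> x \<in> germ_filter s \<xi>"
  by (auto simp: germ_filter_def)

lemma germ_filterE:
  assumes "x \<in> germ_filter s \<xi>"
  obtains e where "e \<in> \<xi>" "s * e \<preceq> x"
  using assms by (auto simp: germ_filter_def)

lemma nat_le_sinv_mult: "a \<preceq> b \<Longrightarrow> sinv a * a \<preceq> sinv b * b"
  by (intro nat_le_mult nat_le_sinv)

text \<open>For a product of an inverse of a member of F with a member of F, a common lower bound c
  of the two members gives \<open>sinv c * c\<close> below it. So the elements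
  \<open>sinv a * a\<close> generate xi_F.\<close>

lemma filter_idem_iff:
  assumes F: "is_filter UNIV F"
  shows "e \<in> filter_idem F \<longleftrightarrow> e \<in> idempotents \<and> (\<exists>a\<in>F. sinv a * a \<preceq> e)"
proof -
  have "\<exists>a\<in>F. sinv a * a \<preceq> e" if "e \<in> filter_mult (set_sinv F) F"
  proof -
    obtain a b where ab: "a \<in> set_sinv F" "b \<in> F" "a * b \<preceq> e"
      using \<open>e \<in> filter_mult (set_sinv F) F\<close> by (rule filter_multE)
    then have "sinv a \<in> F"
      by (simp add: set_sinv_iff)
    then obtain c where c: "c \<in> F" "c \<preceq> sinv a" "c \<preceq> b"
      using filter_directed[OF F _ ab(2)] by blast
    have "sinv c * c \<preceq> a * b"
      using nat_le_mult[OF nat_le_sinv[OF c(2)] c(3)] by simp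
    then show ?thesis
      using ab(3) c(1) nat_le_trans by blast
  qed
  moreover have "e \<in> filter_mult (set_sinv F) F" if "a \<in> F" "sinv a * a \<preceq> e" for a
    using that by (intro filter_multI[of "sinv a" _ a]) (simp_all add: set_sinv_iff)
  ultimately show ?thesis
    by (auto simp: filter_idem_def gsource_def)
qed

text \<open>The source of F is generated by its idempotents, so xi_F determines it; this lets
  composability be tested inside the idempotents.\<close>

lemma filter_source_iff:
  assumes F: "is_filter UNIV F"
  shows "x \<in> filter_mult (set_sinv F) F \<longleftrightarrow> (\<exists>e\<in>filter_idem F. e \<preceq> x)"
proof
  assume "x \<in> filter_mult (set_sinv F) F"
  then obtain a b where ab: "a \<in> set_sinv F" "b \<in> F" "a * b \<preceq> x"
    by (rule filter_multE)
  then have "sinv a \<in> F"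
    by (simp add: set_sinv_iff)
  then obtain c where c: "c \<in> F" "c \<preceq> sinv a" "c \<preceq> b"
    using filter_directed[OF F _ ab(2)] by blast
  have "sinv c * c \<preceq> a * b"
    using nat_le_mult[OF nat_le_sinv[OF c(2)] c(3)] by simp
  then have "sinv c * c \<preceq> x"
    using ab(3) nat_le_trans by blast
  moreover have "sinv c * c \<in> filter_idem F"
    using c(1) by (auto simp: filter_idem_iff[OF F] intro: nat_le_refl)
  ultimately show "\<exists>e\<in>filter_idem F. e \<preceq> x" by blast
next
  assume "\<exists>e\<in>filter_idem F. e \<preceq> x"
  then obtain a e where "a \<in> F" "sinv a * a \<preceq> e" "e \<preceq> x"
    by (auto simp: filter_idem_iff[OF F])
  then show "x \<in> filter_mult (set_sinv F) F"
    using nat_le_trans by (intro filter_multI[of "sinv a" _ a]) (auto simp: set_sinv_iff)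
qed

text \<open>The range of G is the source of its inverse, so composability compares two sources, and
  each is determined by its idempotents.\<close>

lemma filter_source_eq_iff:
  assumes F: "is_filter UNIV F" and G: "is_filter UNIV G"
  shows "filter_mult (set_sinv F) F = filter_mult G (set_sinv G) \<longleftrightarrow>
    filter_idem F = filter_idem (set_sinv G)"
proof
  assume "filter_mult (set_sinv F) F = filter_mult G (set_sinv G)"
  then show "filter_idem F = filter_idem (set_sinv G)"
    by (simp add: filter_idem_def gsource_def)
next
  assume "filter_idem F = filter_idem (set_sinv G)"
  then show "filter_mult (set_sinv F) F = filter_mult G (set_sinv G)"
    using filter_source_iff[OF F] filter_source_iff[OF is_filter_set_sinv[OF G]] by auto
qed

lemma sinv_mult_mem_filter_idem:
  "is_filter UNIV F \<Longrightarrow> a \<in> F \<Longrightarrow> sinv a * a \<in> filter_idem F"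
  by (auto simp: filter_idem_iff intro: nat_le_refl)

lemma filter_idem_proper:
  assumes "F \<in> proper_filters UNIV"
  shows "filter_idem F \<in> proper_filters idempotents"
proof -
  note F = proper_filtersD[OF assms]
  note iff = filter_idem_iff[OF F(1)]
  have "is_filter idempotents (filter_idem F)"
    unfolding is_filter_iff
  proof (intro conjI ballI impI)
    show "filter_idem F \<subseteq> idempotents"
      by (auto simp: iff)
    show "filter_idem F \<noteq> {}"
      using F(1) sinv_mult_mem_filter_idem[OF F(1)] by (auto simp: is_filter_iff[of _ F])
    fix e f
    assume e: "e \<in> filter_idem F"
    { assume "f \<in> idempotents" "e \<preceq> f"
      then show "f \<in> filter_idem F"
        using e nat_le_trans unfolding iff by blast }
    assume f: "f \<in> filter_idem F"
    obtain a b where ab: "a \<in> F" "sinv a * a \<preceq> e" "b \<in> F" "sinv b * b \<preceq> f"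
      using e f by (auto simp: iff)
    obtain c where c: "c \<in> F" "c \<preceq> a" "c \<preceq> b"
      using filter_directed[OF F(1) ab(1,3)] .
    then have "sinv c * c \<preceq> e" "sinv c * c \<preceq> f"
      using ab nat_le_sinv_mult nat_le_trans by blast+
    then show "\<exists>g\<in>filter_idem F. g \<preceq> e \<and> g \<preceq> f"
      using sinv_mult_mem_filter_idem[OF F(1) c(1)] by blast
  qed
  moreover have "0 \<notin> filter_idem F"
    using F(2) by (auto simp: iff nat_le_zero sinv_mult_eq_zero)
  ultimately show ?thesis
    by (simp add: proper_filters_def)
qed

text \<open>Any x in F has a lower bound c in F that is also below s, and c equals
  \<open>s * (sinv c * c)\<close>. Conversely, if \<open>sinv a * a \<preceq> e\<close> with a in F,
  a common lower bound of s and a lies below \<open>s * e\<close>.\<close>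

lemma germ_filter_filter_idem:
  assumes F: "is_filter UNIV F" and s: "s \<in> F"
  shows "germ_filter s (filter_idem F) = F"
proof (intro set_eqI iffI)
  fix x
  assume "x \<in> germ_filter s (filter_idem F)"
  then obtain e where e: "e \<in> filter_idem F" "s * e \<preceq> x"
    by (rule germ_filterE)
  then obtain a where a: "a \<in> F" "sinv a * a \<preceq> e"
    by (auto simp: filter_idem_iff[OF F])
  obtain c where c: "c \<in> F" "c \<preceq> s" "c \<preceq> a"
    using filter_directed[OF F s a(1)] .
  have "c * (sinv c * c) \<preceq> s * e"
    using c a nat_le_sinv_mult nat_le_trans by (blast intro: nat_le_mult)
  then have "c \<preceq> x"
    using e(2) nat_le_trans by (auto simp: inverse_laws_assoc)
  then show "x \<in> F"
    using F c(1) filter_up by blast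
next
  fix x
  assume "x \<in> F"
  then obtain c where c: "c \<in> F" "c \<preceq> s" "c \<preceq> x"
    using filter_directed[OF F s] by blast
  then have "s * (sinv c * c) \<preceq> x"
    using nat_le_right[OF c(2)] by simp
  then show "x \<in> germ_filter s (filter_idem F)"
    using sinv_mult_mem_filter_idem[OF F c(1)] by (blast intro: germ_filterI)
qed

lemma germ_pairs_iff:
  "(s, \<xi>) \<in> germ_pairs \<longleftrightarrow> \<xi> \<in> proper_filters idempotents \<and> sinv s * s \<in> \<xi>"
  by (simp add: germ_pairs_def FE_def)

lemma filter_idem_germ_pairs:
  assumes "F \<in> proper_filters UNIV" "s \<in> F"
  shows "(s, filter_idem F) \<in> germ_pairs"
  using filter_idem_proper[OF assms(1)] sinv_mult_mem_filter_idem[OF proper_filtersD(1)] assms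
  by (auto simp: germ_pairs_iff)

lemma germ_pairsD:
  assumes "(s, \<xi>) \<in> germ_pairs"
  shows "is_filter idempotents \<xi>" "0 \<notin> \<xi>" "sinv s * s \<in> \<xi>"
    and "e \<in> \<xi> \<Longrightarrow> e \<in> idempotents"
  using assms filter_carrier by (auto simp: germ_pairs_iff proper_filters_def)

lemma mem_germ_filter:
  assumes "(s, \<xi>) \<in> germ_pairs"
  shows "s \<in> germ_filter s \<xi>"
  using germ_pairsD(3)[OF assms] by (rule germ_filterI) (simp add: inverse_laws_assoc)

lemma germ_filter_proper:
  assumes s: "(s, \<xi>) \<in> germ_pairs"
  shows "germ_filter s \<xi> \<in> proper_filters UNIV"
proof -
  note \<xi> = germ_pairsD[OF s]
  have "is_filter UNIV (germ_filter s \<xi>)"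
    unfolding is_filter_iff
  proof (intro conjI ballI impI)
    show "germ_filter s \<xi> \<noteq> {}"
      using mem_germ_filter[OF s] by blast
    fix x y
    assume x: "x \<in> germ_filter s \<xi>"
    { assume "x \<preceq> y"
      then show "y \<in> germ_filter s \<xi>"
        using x nat_le_trans unfolding germ_filter_def by blast }
    assume y: "y \<in> germ_filter s \<xi>"
    obtain e f where ef: "e \<in> \<xi>" "s * e \<preceq> x" "f \<in> \<xi>" "s * f \<preceq> y"
      using x y by (auto elim!: germ_filterE)
    obtain g where g: "g \<in> \<xi>" "g \<preceq> e" "g \<preceq> f"
      using filter_directed[OF \<xi>(1) ef(1,3)] .
    have "s * g \<preceq> x" "s * g \<preceq> y"
      using ef g nat_le_mult[OF nat_le_refl] nat_le_trans by blast+
    then show "\<exists>z\<in>germ_filter s \<xi>. z \<preceq> x \<and> z \<preceq> y"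
      using g(1) germ_filterI[OF _ nat_le_refl] by blast
  qed simp
  moreover have "0 \<notin> germ_filter s \<xi>"
  proof
    assume "0 \<in> germ_filter s \<xi>"
    then obtain e where e: "e \<in> \<xi>" "s * e = 0"
      by (auto simp: nat_le_zero elim: germ_filterE)
    \<comment> \<open>Membership of \<open>sinv s * s\<close> in \<open>\<xi>\<close> enters here:
      it turns \<open>s * e = 0\<close> into 0 being a member of \<open>\<xi>\<close>.\<close>
    have "sinv s * s * e \<in> \<xi>"
      using filter_idempotents_mult[OF \<xi>(1) \<xi>(3) e(1)] .
    then show False
      using e(2) \<xi>(2) by (simp add: mult.assoc)
  qed
  ultimately show ?thesis
    by (simp add: proper_filters_def)
qed

text \<open>The generators \<open>s * e\<close> have source \<open>e * (sinv s * s) * e\<close>.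
  This lies in \<open>\<xi>\<close>, which gives one inclusion, and below e, which gives the
  other.\<close>

lemma filter_idem_germ_filter:
  assumes s: "(s, \<xi>) \<in> germ_pairs"
  shows "filter_idem (germ_filter s \<xi>) = \<xi>"
proof (intro set_eqI iffI)
  note \<xi> = germ_pairsD[OF s]
  note iff = filter_idem_iff[OF proper_filtersD(1)[OF germ_filter_proper[OF s]]]
  have eq: "sinv (s * e) * (s * e) = e * (sinv s * s) * e" if "e \<in> \<xi>" for e
    using \<xi>(4)[OF that] by (simp add: sinv_mult sinv_idempotent mult.assoc)
  fix f
  { assume "f \<in> filter_idem (germ_filter s \<xi>)"
    then obtain a e where f: "f \<in> idempotents" and ae: "sinv a * a \<preceq> f" "e \<in> \<xi>" "s * e \<preceq> a"
      by (auto simp: iff elim: germ_filterE)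
    have "sinv (s * e) * (s * e) \<in> \<xi>"
      unfolding eq[OF ae(2)] by (rule filter_idempotents_mult[OF \<xi>(1) filter_idempotents_mult[OF \<xi>(1) ae(2) \<xi>(3)] ae(2)])
    moreover have "sinv (s * e) * (s * e) \<preceq> f"
      using ae nat_le_sinv_mult nat_le_trans by blast
    ultimately show "f \<in> \<xi>"
      using \<xi>(1) f unfolding is_filter_iff by blast }
  assume f: "f \<in> \<xi>"
  have "f * (sinv s * s) * f \<preceq> f"
    by (rule idempotent_mult_nat_le, rule idempotent_mult) (simp_all add: \<xi>(4)[OF f])
  then have "sinv (s * f) * (s * f) \<preceq> f"
    unfolding eq[OF f] .
  then show "f \<in> filter_idem (germ_filter s \<xi>)"
    using f \<xi>(4)[OF f] unfolding iff by (blast intro: germ_filterI nat_le_refl)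
qed

section \<open>Germs as equivalence classes, compared with filters\<close>

lemma equiv_germ_rel: "equiv germ_pairs (germ_rel :: (('a::inverse_semigroup_zero \<times> 'a set) \<times> _) set)"
  (is "equiv ?P ?R")
proof (rule equivI)
  show "?R \<subseteq> ?P \<times> ?P"
    by (auto simp: germ_rel_def)
  show "refl_on ?P ?R"
    by (auto simp: refl_on_def germ_rel_def dest: germ_pairsD(3))
  show "sym ?R"
    unfolding sym_def germ_rel_def by (clarsimp, metis)
  show "trans ?R"
  proof (rule transI)
    fix x y z :: "'a \<times> 'a set"
    assume "(x, y) \<in> germ_rel" "(y, z) \<in> germ_rel"
    then obtain s t u \<xi> e f where xyz: "x = (s, \<xi>)" "y = (t, \<xi>)" "z = (u, \<xi>)"
      and *: "(s, \<xi>) \<in> germ_pairs" "(u, \<xi>) \<in> germ_pairs" "e \<in> \<xi>" "f \<in> \<xi>"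
      and eq: "s * e = t * e" "t * f = u * f"
      unfolding germ_rel_def by blast
    \<comment> \<open>The product of the two witnesses serves for s and u; commuting it brings f
      next to u.\<close>
    have c: "e * f = f * e"
      using * by (intro idempotent_commute germ_pairsD(4))
    have "s * (e * f) = t * (e * f)"
      using eq(1) by (simp add: mult.assoc[symmetric])
    also have "\<dots> = u * (e * f)"
      unfolding c using eq(2) by (simp add: mult.assoc[symmetric])
    finally show "(x, z) \<in> germ_rel"
      using * xyz filter_idempotents_mult[OF germ_pairsD(1)[OF *(1)] *(3,4)]
      by (auto simp: germ_rel_def)
  qed
qed

text \<open>If \<open>s * e = t * e\<close>, then \<open>t * (e * f) = s * (e * f)\<close> lies
  below \<open>s * f\<close>, so each filter contains the other. If the filters agree, s and t have
  a common lower bound c in them, and \<open>sinv c * c\<close> witnesses equality of germs because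
  both products with it are c.\<close>

lemma germ_eq_germ_iff:
  assumes s: "(s, \<xi>) \<in> germ_pairs" and t: "(t, \<eta>) \<in> germ_pairs"
  shows "germ s \<xi> = germ t \<eta> \<longleftrightarrow> germ_filter s \<xi> = germ_filter t \<eta>"
proof -
  have "germ s \<xi> = germ t \<eta> \<longleftrightarrow> ((s, \<xi>), (t, \<eta>)) \<in> germ_rel"
    unfolding germ_def using eq_equiv_class_iff[OF equiv_germ_rel s t] .
  also have "\<dots> \<longleftrightarrow> germ_filter s \<xi> = germ_filter t \<eta>"
  proof
    have sub: "germ_filter s \<xi> \<subseteq> germ_filter t \<xi>"
      if s: "(s, \<xi>) \<in> germ_pairs" and e: "e \<in> \<xi>" "s * e = t * e" for s t e
    proof
      fix x
      assume "x \<in> germ_filter s \<xi>"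
      then obtain f where f: "f \<in> \<xi>" "s * f \<preceq> x"
        by (rule germ_filterE)
      have "t * (e * f) = s * (e * f)"
        using e(2) by (simp add: mult.assoc[symmetric])
      also have "\<dots> \<preceq> s * f"
        using germ_pairsD(4)[OF s e(1)] by (intro nat_le_mult nat_le_refl idempotent_mult_nat_le)
      finally have "t * (e * f) \<preceq> x"
        using f(2) nat_le_trans by blast
      then show "x \<in> germ_filter t \<xi>"
        using filter_idempotents_mult[OF germ_pairsD(1)[OF s] e(1) f(1)] by (blast intro: germ_filterI)
    qed
    assume "((s, \<xi>), (t, \<eta>)) \<in> germ_rel"
    then obtain e where "\<eta> = \<xi>" "e \<in> \<xi>" "s * e = t * e"
      by (auto simp: germ_rel_def)
    then show "germ_filter s \<xi> = germ_filter t \<eta>"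
      using sub[of s e t] sub[of t e s] s t by auto
  next
    assume eq: "germ_filter s \<xi> = germ_filter t \<eta>"
    note F = proper_filtersD(1)[OF germ_filter_proper[OF s]]
    have \<xi>: "\<xi> = \<eta>"
      using filter_idem_germ_filter[OF s] filter_idem_germ_filter[OF t] eq by simp
    have "s \<in> germ_filter s \<xi>" "t \<in> germ_filter s \<xi>"
      using mem_germ_filter[OF s] mem_germ_filter[OF t] eq by simp_all
    then obtain c where c: "c \<in> germ_filter s \<xi>" "c \<preceq> s" "c \<preceq> t"
      using filter_directed[OF F] by blast
    have "sinv c * c \<in> \<xi>"
      using sinv_mult_mem_filter_idem[OF F c(1)] by (simp add: filter_idem_germ_filter[OF s])
    moreover have "s * (sinv c * c) = t * (sinv c * c)"
      using nat_le_right[OF c(2)] nat_le_right[OF c(3)] by simp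
    ultimately show "((s, \<xi>), (t, \<eta>)) \<in> germ_rel"
      using s t \<xi> by (auto simp: germ_rel_def)
  qed
  finally show ?thesis .
qed

section \<open>The comparison map as a bijection\<close>

lemma germ_map_eq:
  assumes F: "F \<in> proper_filters UNIV" and s: "s \<in> F"
  shows "germ_map F = germ s (filter_idem F)"
  unfolding germ_map_def
proof (rule the_equality)
  show "\<exists>t\<in>F. germ s (filter_idem F) = germ t (filter_idem F)"
    using s by blast
  fix g
  assume "\<exists>t\<in>F. g = germ t (filter_idem F)"
  then obtain t where t: "t \<in> F" "g = germ t (filter_idem F)" by blast
  then show "g = germ s (filter_idem F)"
    using germ_eq_germ_iff[OF filter_idem_germ_pairs[OF F t(1)] filter_idem_germ_pairs[OF F s]]
      germ_filter_filter_idem[OF proper_filtersD(1)[OF F]] s t by simp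
qed

lemma germ_map_germ_filter:
  assumes "(s, \<xi>) \<in> germ_pairs"
  shows "germ_map (germ_filter s \<xi>) = germ s \<xi>"
  using germ_map_eq[OF germ_filter_proper[OF assms] mem_germ_filter[OF assms]]
  by (simp add: filter_idem_germ_filter[OF assms])

text \<open>This translates any statement about representatives of the germ of F into one about F,
  and so removes every choice of representatives from the later arguments.\<close>

lemma germ_map_eq_germ_iff:
  assumes F: "F \<in> proper_filters UNIV" and s: "(s, \<xi>) \<in> germ_pairs"
  shows "germ_map F = germ s \<xi> \<longleftrightarrow> F = germ_filter s \<xi>"
proof
  obtain t where t: "t \<in> F"
    using filter_nonempty[OF proper_filtersD(1)[OF F]] .
  assume "germ_map F = germ s \<xi>"
  then show "F = germ_filter s \<xi>"
    using germ_eq_germ_iff[OF filter_idem_germ_pairs[OF F t] s]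
    by (simp add: germ_map_eq[OF F t] germ_filter_filter_idem[OF proper_filtersD(1)[OF F] t])
qed (simp add: germ_map_germ_filter[OF s])

lemma inj_on_germ_map: "inj_on germ_map (proper_filters UNIV)"
proof (rule inj_onI)
  fix F G :: "'a set"
  assume F: "F \<in> proper_filters UNIV" and G: "G \<in> proper_filters UNIV"
    and eq: "germ_map F = germ_map G"
  obtain t where t: "t \<in> G"
    using filter_nonempty[OF proper_filtersD(1)[OF G]] .
  show "F = G"
    using eq germ_map_eq_germ_iff[OF F filter_idem_germ_pairs[OF G t]]
    by (simp add: germ_map_eq[OF G t] germ_filter_filter_idem[OF proper_filtersD(1)[OF G] t])
qed

lemma filter_germ_cases:
  assumes "F \<in> proper_filters UNIV"
  obtains s where "s \<in> F" "(s, filter_idem F) \<in> germ_pairs" "F = germ_filter s (filter_idem F)"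
    "germ_map F = germ s (filter_idem F)"
proof -
  obtain s where "s \<in> F"
    using filter_nonempty[OF proper_filtersD(1)[OF assms]] .
  then show thesis
    using that assms filter_idem_germ_pairs germ_filter_filter_idem[OF proper_filtersD(1)] germ_map_eq
    by metis
qed

lemma germ_map_image:
  "germ_map ` proper_filters UNIV = arrows (germ_groupoid :: 'a::inverse_semigroup_zero germ groupoid_data)"
proof -
  have "arrows (germ_groupoid :: 'a germ groupoid_data) = {germ s \<xi> | s \<xi>. (s, \<xi>) \<in> germ_pairs}"
    by (auto simp: germ_groupoid_def quotient_def germ_def)
  also have "\<dots> = germ_map ` proper_filters UNIV"
  proof (intro set_eqI iffI)
    fix g :: "'a germ"
    assume "g \<in> {germ s \<xi> | s \<xi>. (s, \<xi>) \<in> germ_pairs}"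
    then show "g \<in> germ_map ` proper_filters UNIV"
      using germ_map_germ_filter[symmetric] germ_filter_proper by blast
  next
    fix g :: "'a germ"
    assume "g \<in> germ_map ` proper_filters UNIV"
    then obtain F where F: "F \<in> proper_filters UNIV" and g: "g = germ_map F" by blast
    obtain s where "(s, filter_idem F) \<in> germ_pairs" "germ_map F = germ s (filter_idem F)"
      using F by (rule filter_germ_cases)
    then show "g \<in> {germ s \<xi> | s \<xi>. (s, \<xi>) \<in> germ_pairs}"
      using g by blast
  qed
  finally show ?thesis by simp
qed

section \<open>Product and inverse under the comparison map\<close>

lemma filter_idem_filter_mult:
  assumes "(F, G) \<in> composable filter_groupoid"
  shows "filter_idem (filter_mult F G) = filter_idem G"
  using assms filter_mult_source[of F G]
  by (simp add: filter_idem_def gsource_def composable_filter_groupoid proper_filters_def)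

text \<open>Since e is idempotent, \<open>t * e * sinv t\<close> is the range idempotent of
  \<open>t * e\<close>, and the elements \<open>t * e\<close> generate the filter. Thus
  \<open>beta\<close> computes the idempotent part of the range of that filter.\<close>

lemma beta_eq:
  assumes t: "(t, \<eta>) \<in> germ_pairs"
  shows "beta t \<eta> = filter_idem (set_sinv (germ_filter t \<eta>))"
proof -
  note F = is_filter_set_sinv[OF proper_filtersD(1)[OF germ_filter_proper[OF t]]]
  have eq: "t * e * sinv (t * e) = t * e * sinv t" if "e \<in> \<eta>" for e
    using germ_pairsD(4)[OF t that]
    by (simp add: sinv_mult sinv_idempotent mult.assoc idempotent_mult_self_assoc)
  have "(\<exists>e\<in>\<eta>. t * e * sinv t \<preceq> f) \<longleftrightarrow> (\<exists>a\<in>set_sinv (germ_filter t \<eta>). sinv a * a \<preceq> f)" for f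
  proof
    assume "\<exists>e\<in>\<eta>. t * e * sinv t \<preceq> f"
    then obtain e where e: "e \<in> \<eta>" "t * e * sinv (t * e) \<preceq> f"
      using eq by auto
    then show "\<exists>a\<in>set_sinv (germ_filter t \<eta>). sinv a * a \<preceq> f"
      by (intro bexI[of _ "sinv (t * e)"])
        (auto simp: set_sinv_iff intro: germ_filterI nat_le_refl)
  next
    assume "\<exists>a\<in>set_sinv (germ_filter t \<eta>). sinv a * a \<preceq> f"
    then obtain a e where ae: "sinv a * a \<preceq> f" "e \<in> \<eta>" "t * e \<preceq> sinv a"
      by (auto simp: set_sinv_iff elim!: germ_filterE)
    have "t * e * sinv (t * e) \<preceq> sinv a * a"
      using nat_le_mult[OF ae(3) nat_le_sinv[OF ae(3)]] by simp
    then show "\<exists>e\<in>\<eta>. t * e * sinv t \<preceq> f"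
      using ae nat_le_trans by (auto simp: eq)
  qed
  then show ?thesis
    by (auto simp: beta_def filter_idem_iff[OF F])
qed

lemma composable_germ_filter_iff:
  assumes "(s, \<xi>) \<in> germ_pairs" "(t, \<eta>) \<in> germ_pairs"
  shows "(germ_filter s \<xi>, germ_filter t \<eta>) \<in> composable filter_groupoid \<longleftrightarrow> \<xi> = beta t \<eta>"
  using assms filter_source_eq_iff[OF germ_filter_proper[THEN proper_filtersD(1)]
      germ_filter_proper[THEN proper_filtersD(1)], OF assms]
  by (simp add: composable_filter_groupoid germ_filter_proper filter_idem_germ_filter beta_eq)

text \<open>The product filter contains \<open>s * t\<close> and has idempotent part
  \<open>\<eta>\<close>, and these two data determine a filter; no computation with generators is
  required.\<close>

lemma germ_filter_mult:
  assumes s: "(s, beta t \<eta>) \<in> germ_pairs" and t: "(t, \<eta>) \<in> germ_pairs"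
  shows germ_pairs_mult: "(s * t, \<eta>) \<in> germ_pairs"
    and filter_mult_germ_filter:
      "filter_mult (germ_filter s (beta t \<eta>)) (germ_filter t \<eta>) = germ_filter (s * t) \<eta>"
proof -
  let ?F = "germ_filter s (beta t \<eta>)" and ?G = "germ_filter t \<eta>"
  have c: "(?F, ?G) \<in> composable filter_groupoid"
    using composable_germ_filter_iff[OF s t] by simp
  then have FG: "filter_mult ?F ?G \<in> proper_filters UNIV"
    by (simp add: composable_filter_groupoid filter_mult_proper)
  have eq: "filter_idem (filter_mult ?F ?G) = \<eta>"
    using filter_idem_filter_mult[OF c] filter_idem_germ_filter[OF t] by simp
  have st: "s * t \<in> filter_mult ?F ?G"
    using mem_germ_filter[OF s] mem_germ_filter[OF t] nat_le_refl by (rule filter_multI)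
  show "(s * t, \<eta>) \<in> germ_pairs"
    using filter_idem_germ_pairs[OF FG st] eq by simp
  show "filter_mult ?F ?G = germ_filter (s * t) \<eta>"
    using germ_filter_filter_idem[OF proper_filtersD(1)[OF FG] st] eq by simp
qed

lemma germ_filter_sinv:
  assumes s: "(s, \<xi>) \<in> germ_pairs"
  shows germ_pairs_sinv: "(sinv s, beta s \<xi>) \<in> germ_pairs"
    and set_sinv_germ_filter: "set_sinv (germ_filter s \<xi>) = germ_filter (sinv s) (beta s \<xi>)"
proof -
  have F: "set_sinv (germ_filter s \<xi>) \<in> proper_filters UNIV"
    by (rule set_sinv_proper[OF germ_filter_proper[OF s]])
  have s': "sinv s \<in> set_sinv (germ_filter s \<xi>)"
    using mem_germ_filter[OF s] by (simp add: set_sinv_iff)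
  show "(sinv s, beta s \<xi>) \<in> germ_pairs"
    using filter_idem_germ_pairs[OF F s'] by (simp add: beta_eq[OF s])
  show "set_sinv (germ_filter s \<xi>) = germ_filter (sinv s) (beta s \<xi>)"
    using germ_filter_filter_idem[OF proper_filtersD(1)[OF F] s'] by (simp add: beta_eq[OF s])
qed

text \<open>Every admissible choice of representatives in the definite description has F and G as
  its filters, so it yields the germ of the product filter. This gives existence and uniqueness of
  the described value together.\<close>

lemma germ_mult_germ_map:
  assumes FG: "(F, G) \<in> composable filter_groupoid"
  shows "germ_mult (germ_map F) (germ_map G) = germ_map (filter_mult F G)"
  unfolding germ_mult_def
proof (rule the_equality)
  have F: "F \<in> proper_filters UNIV" and G: "G \<in> proper_filters UNIV"
    using FG by (auto simp: composable_filter_groupoid)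
  obtain s where s: "(s, filter_idem F) \<in> germ_pairs" "F = germ_filter s (filter_idem F)"
    "germ_map F = germ s (filter_idem F)"
    using F by (rule filter_germ_cases)
  obtain t where t: "(t, filter_idem G) \<in> germ_pairs" "G = germ_filter t (filter_idem G)"
    "germ_map G = germ t (filter_idem G)"
    using G by (rule filter_germ_cases)
  have b: "filter_idem F = beta t (filter_idem G)"
    using composable_germ_filter_iff[OF s(1) t(1)] FG s(2) t(2) by simp
  have "germ_map (filter_mult F G) = germ (s * t) (filter_idem G)"
    using germ_filter_mult[OF s(1)[unfolded b] t(1)] germ_map_germ_filter s(2) t(2) b by simp
  then show "\<exists>s t \<eta>. (s, beta t \<eta>) \<in> germ_pairs \<and> (t, \<eta>) \<in> germ_pairs \<and>
      germ_map F = germ s (beta t \<eta>) \<and> germ_map G = germ t \<eta> \<and>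
      germ_map (filter_mult F G) = germ (s * t) \<eta>"
    using s(1,3) t(1,3) b by metis
  fix k
  assume "\<exists>s t \<eta>. (s, beta t \<eta>) \<in> germ_pairs \<and> (t, \<eta>) \<in> germ_pairs \<and>
      germ_map F = germ s (beta t \<eta>) \<and> germ_map G = germ t \<eta> \<and> k = germ (s * t) \<eta>"
  then obtain s t \<eta> where st: "(s, beta t \<eta>) \<in> germ_pairs" "(t, \<eta>) \<in> germ_pairs"
    and "germ_map F = germ s (beta t \<eta>)" "germ_map G = germ t \<eta>" and k: "k = germ (s * t) \<eta>"
    by blast
  then have "F = germ_filter s (beta t \<eta>)" "G = germ_filter t \<eta>"
    using germ_map_eq_germ_iff F G by blast+
  then show "k = germ_map (filter_mult F G)"
    using germ_map_germ_filter[OF germ_pairs_mult[OF st]] k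
    by (simp add: filter_mult_germ_filter[OF st])
qed

lemma germ_inv_germ_map:
  assumes F: "F \<in> proper_filters UNIV"
  shows "germ_inv (germ_map F) = germ_map (set_sinv F)"
  unfolding germ_inv_def
proof (rule the_equality)
  have eq: "germ_map (set_sinv F) = germ (sinv s) (beta s \<xi>)"
    if "(s, \<xi>) \<in> germ_pairs" "F = germ_filter s \<xi>" for s \<xi>
    using that germ_map_germ_filter[OF germ_pairs_sinv] by (simp add: set_sinv_germ_filter)
  obtain s where "(s, filter_idem F) \<in> germ_pairs" "F = germ_filter s (filter_idem F)"
    "germ_map F = germ s (filter_idem F)"
    using F by (rule filter_germ_cases)
  then show "\<exists>s \<xi>. (s, \<xi>) \<in> germ_pairs \<and> germ_map F = germ s \<xi> \<and>
      germ_map (set_sinv F) = germ (sinv s) (beta s \<xi>)"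
    using eq by blast
  fix k
  assume "\<exists>s \<xi>. (s, \<xi>) \<in> germ_pairs \<and> germ_map F = germ s \<xi> \<and> k = germ (sinv s) (beta s \<xi>)"
  then obtain s \<xi> where "(s, \<xi>) \<in> germ_pairs" "germ_map F = germ s \<xi>" "k = germ (sinv s) (beta s \<xi>)"
    by blast
  then show "k = germ_map (set_sinv F)"
    using eq germ_map_eq_germ_iff[OF F] by simp
qed

text \<open>An equality, not just preservation: lifting arbitrary composable germs to composable
  filters is what later transports the groupoid laws.\<close>

lemma composable_germ_groupoid:
  "composable germ_groupoid = map_prod germ_map germ_map ` composable filter_groupoid"
proof (intro equalityI subsetI)
  fix p :: "'a germ \<times> 'a germ"
  assume "p \<in> composable germ_groupoid"
  then obtain s \<xi> t \<eta> where p: "p = (germ s \<xi>, germ t \<eta>)"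
    and st: "(s, \<xi>) \<in> germ_pairs" "(t, \<eta>) \<in> germ_pairs" "\<xi> = beta t \<eta>"
    by (auto simp: germ_groupoid_def)
  then have "(germ_filter s \<xi>, germ_filter t \<eta>) \<in> composable filter_groupoid"
    using composable_germ_filter_iff by blast
  moreover have "p = map_prod germ_map germ_map (germ_filter s \<xi>, germ_filter t \<eta>)"
    using p st(1,2) by (simp add: germ_map_germ_filter)
  ultimately show "p \<in> map_prod germ_map germ_map ` composable filter_groupoid" by blast
next
  fix p :: "'a germ \<times> 'a germ"
  assume "p \<in> map_prod germ_map germ_map ` composable filter_groupoid"
  then obtain F G where p: "p = (germ_map F, germ_map G)"
    and FG: "(F, G) \<in> composable filter_groupoid"
    by auto
  have F: "F \<in> proper_filters UNIV" and G: "G \<in> proper_filters UNIV"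
    using FG by (auto simp: composable_filter_groupoid)
  obtain s where s: "(s, filter_idem F) \<in> germ_pairs" "F = germ_filter s (filter_idem F)"
    "germ_map F = germ s (filter_idem F)"
    using F by (rule filter_germ_cases)
  obtain t where t: "(t, filter_idem G) \<in> germ_pairs" "G = germ_filter t (filter_idem G)"
    "germ_map G = germ t (filter_idem G)"
    using G by (rule filter_germ_cases)
  have "filter_idem F = beta t (filter_idem G)"
    using composable_germ_filter_iff[OF s(1) t(1)] FG s(2) t(2) by simp
  then show "p \<in> composable germ_groupoid"
    unfolding germ_groupoid_def using p s t by auto
qed


section \<open>Ultrafilters\<close>

lemma ultrafilters_subset: "ultrafilters S \<subseteq> proper_filters S"
  by (auto simp: ultrafilters_def)

lemma ultrafilter_maximal:
  "F \<in> ultrafilters S \<Longrightarrow> G \<in> proper_filters S \<Longrightarrow> F \<subseteq> G \<Longrightarrow> G = F"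
  unfolding ultrafilters_def by blast

lemma filter_idem_mono:
  assumes "F \<in> proper_filters UNIV" "G \<in> proper_filters UNIV" "F \<subseteq> G"
  shows "filter_idem F \<subseteq> filter_idem G"
  using assms(3)
  by (clarsimp simp: filter_idem_iff[OF proper_filtersD(1)[OF assms(1)]]
      filter_idem_iff[OF proper_filtersD(1)[OF assms(2)]]) blast

lemma germ_filter_mono: "\<xi> \<subseteq> \<eta> \<Longrightarrow> germ_filter s \<xi> \<subseteq> germ_filter s \<eta>"
  unfolding germ_filter_def by blast

text \<open>Fix s in F. Then \<open>filter_idem\<close> and \<open>germ_filter s\<close> are
  mutually inverse monotone maps between the proper filters containing s and the proper filters of
  idempotents containing \<open>sinv s * s\<close>. Extensions of F still contain s, and those of
  xi_F still contain \<open>sinv s * s\<close>, so maximality corresponds.\<close>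

lemma ultrafilter_iff_filter_idem:
  assumes F: "F \<in> proper_filters UNIV"
  shows "F \<in> ultrafilters UNIV \<longleftrightarrow> filter_idem F \<in> ultrafilters idempotents"
proof
  obtain s where s: "s \<in> F" "(s, filter_idem F) \<in> germ_pairs" "F = germ_filter s (filter_idem F)"
    using F by (rule filter_germ_cases)
  { assume U: "F \<in> ultrafilters UNIV"
    have "\<eta> = filter_idem F" if \<eta>: "\<eta> \<in> proper_filters idempotents" "filter_idem F \<subseteq> \<eta>" for \<eta>
    proof -
      have \<eta>': "(s, \<eta>) \<in> germ_pairs"
        using \<eta> s(2) by (auto simp: germ_pairs_iff)
      have "F \<subseteq> germ_filter s \<eta>"
        using germ_filter_mono[OF \<eta>(2), of s] unfolding s(3)[symmetric] .
      then have "germ_filter s \<eta> = F"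
        by (rule ultrafilter_maximal[OF U germ_filter_proper[OF \<eta>']])
      then show ?thesis
        using filter_idem_germ_filter[OF \<eta>'] by metis
    qed
    then show "filter_idem F \<in> ultrafilters idempotents"
      using filter_idem_proper[OF F] unfolding ultrafilters_def by blast }
  assume U: "filter_idem F \<in> ultrafilters idempotents"
  have "G = F" if G: "G \<in> proper_filters UNIV" "F \<subseteq> G" for G
  proof -
    have "filter_idem G = filter_idem F"
      by (rule ultrafilter_maximal[OF U filter_idem_proper[OF G(1)] filter_idem_mono[OF F G]])
    moreover have "germ_filter s (filter_idem G) = G"
      using G(2) s(1) by (intro germ_filter_filter_idem[OF proper_filtersD(1)[OF G(1)]]) blast
    ultimately show ?thesis
      using s(3) by metis
  qed
  then show "F \<in> ultrafilters UNIV"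
    using F unfolding ultrafilters_def by blast
qed

lemma set_sinv_ultrafilter:
  assumes F: "F \<in> ultrafilters UNIV"
  shows "set_sinv F \<in> ultrafilters UNIV"
proof -
  have "G = set_sinv F" if G: "G \<in> proper_filters UNIV" "set_sinv F \<subseteq> G" for G
  proof -
    have "F \<subseteq> set_sinv G"
      using G(2) by (auto simp: set_sinv_iff subset_iff)
    then have "set_sinv G = F"
      by (rule ultrafilter_maximal[OF F set_sinv_proper[OF G(1)]])
    then show ?thesis by auto
  qed
  moreover have "set_sinv F \<in> proper_filters UNIV"
    using F ultrafilters_subset set_sinv_proper by blast
  ultimately show ?thesis
    unfolding ultrafilters_def by blast
qed

text \<open>Maximality is visible in the idempotent part, and the product has that of its right
  factor.\<close>

lemma filter_mult_ultrafilter: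
  assumes FG: "(F, G) \<in> composable filter_groupoid" and G: "G \<in> ultrafilters UNIV"
  shows "filter_mult F G \<in> ultrafilters UNIV"
  using FG G filter_idem_filter_mult[OF FG]
  by (simp add: ultrafilter_iff_filter_idem composable_filter_groupoid filter_mult_proper)

lemma ultragerms_eq: "ultragerms = germ_map ` ultrafilters UNIV"
proof (intro equalityI subsetI)
  fix g :: "'a germ"
  assume "g \<in> ultragerms"
  then obtain s \<xi> where g: "g = germ s \<xi>" and s: "(s, \<xi>) \<in> germ_pairs" and \<xi>: "\<xi> \<in> ultrafilters idempotents"
    by (auto simp: ultragerms_def)
  have "germ_filter s \<xi> \<in> ultrafilters UNIV"
    using \<xi> by (simp add: ultrafilter_iff_filter_idem[OF germ_filter_proper[OF s]]
        filter_idem_germ_filter[OF s])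
  then show "g \<in> germ_map ` ultrafilters UNIV"
    unfolding g germ_map_germ_filter[OF s, symmetric] by (rule imageI)
next
  fix g :: "'a germ"
  assume "g \<in> germ_map ` ultrafilters UNIV"
  then obtain F where F: "F \<in> ultrafilters UNIV" and g: "g = germ_map F" by blast
  then have F': "F \<in> proper_filters UNIV"
    using ultrafilters_subset by blast
  then obtain s where "(s, filter_idem F) \<in> germ_pairs" "germ_map F = germ s (filter_idem F)"
    by (rule filter_germ_cases)
  then show "g \<in> ultragerms"
    using F g ultrafilter_iff_filter_idem[OF F'] by (auto simp: ultragerms_def)
qed


section \<open>The patch topologies\<close>

lemma openin_patch_basic:
  "s \<in> S \<Longrightarrow> finite T \<Longrightarrow> T \<subseteq> down S s \<Longrightarrow> openin (patch_topology S) (patch_basic S s T)"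
  unfolding patch_topology_def by (rule topology_generated_by_Basis) blast

lemma topspace_patch_topology [simp]: "topspace (patch_topology S) = proper_filters S"
proof
  show "topspace (patch_topology S) \<subseteq> proper_filters S"
    unfolding patch_topology_def by (auto simp: patch_basic_def)
  show "proper_filters S \<subseteq> topspace (patch_topology S)"
  proof
    fix F
    assume F: "F \<in> proper_filters S"
    obtain s where s: "s \<in> F"
      using filter_nonempty[OF proper_filtersD(1)[OF F]] .
    then have "F \<in> patch_basic S s {}" "s \<in> S"
      using F filter_carrier[OF proper_filtersD(1)[OF F]] by (auto simp: patch_basic_def)
    then show "F \<in> topspace (patch_topology S)"
      using openin_subset[OF openin_patch_basic[of s S "{}"]] by auto
  qed
qed

lemma continuous_map_patch_topology:
  assumes "f \<in> topspace X \<rightarrow> proper_filters S"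
    and "\<And>s T. s \<in> S \<Longrightarrow> finite T \<Longrightarrow> T \<subseteq> down S s \<Longrightarrow>
      openin X (f -` patch_basic S s T \<inter> topspace X)"
  shows "continuous_map X (patch_topology S) f"
  unfolding patch_topology_def
proof (rule continuous_on_generated_topo)
  have "f ` topspace X \<subseteq> topspace (patch_topology S)"
    using assms(1) by auto
  then show "f ` topspace X \<subseteq> \<Union> {patch_basic S s T | s T. s \<in> S \<and> finite T \<and> T \<subseteq> down S s}"
    unfolding patch_topology_def by simp
qed (use assms(2) in blast)

text \<open>Keeps translated exclusion sets below the translated included element, as a basic patch
  set demands.\<close>

lemma image_down:
  assumes "T \<subseteq> down S s" "\<And>x y. x \<preceq> y \<Longrightarrow> f x \<preceq> f y"
  shows "f ` T \<subseteq> down UNIV (f s)"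
  using assms by (auto simp: down_def)

text \<open>Multiplying by \<open>sinv t\<close> cancels G on the right; conversely
  \<open>x * sinv t * t\<close> lies below x.\<close>

lemma mem_filter_mult_iff:
  assumes FG: "(F, G) \<in> composable filter_groupoid" and t: "t \<in> G"
  shows "x \<in> filter_mult F G \<longleftrightarrow> x * sinv t \<in> F"
proof
  have F: "is_filter UNIV F" and G: "is_filter UNIV G"
    and eq: "filter_mult (set_sinv F) F = filter_mult G (set_sinv G)"
    using FG by (simp_all add: composable_filter_groupoid proper_filters_def)
  { assume x: "x \<in> filter_mult F G"
    have "sinv t \<in> set_sinv G"
      using t by (simp add: set_sinv_iff)
    with x have "x * sinv t \<in> filter_mult (filter_mult F G) (set_sinv G)"
      by (rule filter_multI) simp
    then show "x * sinv t \<in> F"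
      unfolding filter_mult_cancel_right[OF F G eq] . }
  have "x * sinv t * t \<preceq> x"
    unfolding mult.assoc by (rule mult_idempotent_nat_le) simp
  moreover assume "x * sinv t \<in> F"
  ultimately show "x \<in> filter_mult F G"
    using t by (blast intro: filter_multI)
qed

lemma topological_groupoid_filter_groupoid:
  "topological_groupoid filter_groupoid (patch_topology UNIV)"
  unfolding topological_groupoid_def filter_groupoid_simps
proof (intro conjI is_groupoid_filter_groupoid topspace_patch_topology)
  let ?C = "composable (filter_groupoid :: 'a set groupoid_data)"
  let ?P = "patch_topology (UNIV :: 'a set)"
  have C: "?C \<subseteq> proper_filters UNIV \<times> proper_filters UNIV"
    by (auto simp: composable_filter_groupoid)
  show "continuous_map (subtopology (prod_topology ?P ?P) ?C) ?P (\<lambda>(F, G). filter_mult F G)"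
  proof (rule continuous_map_patch_topology)
    show "(\<lambda>(F, G). filter_mult F G)
        \<in> topspace (subtopology (prod_topology ?P ?P) ?C) \<rightarrow> proper_filters UNIV"
      by (auto simp: composable_filter_groupoid filter_mult_proper)
    fix u :: 'a and T
    assume T: "finite T" "T \<subseteq> down UNIV u"
    \<comment> \<open>For t in G, containing u and avoiding T becomes, for F, containing
      \<open>u * sinv t\<close> and avoiding the translates of T by \<open>sinv t\<close>. The
      second factor only records that t is in G, and the union runs over all candidates for
      t.\<close>
    define W where "W = (\<Union>t. patch_basic UNIV (u * sinv t) ((\<lambda>x. x * sinv t) ` T) \<times> patch_basic UNIV t {})"
    have "openin (prod_topology ?P ?P) W"
      unfolding W_def
    proof (rule openin_Union, clarify)
      fix t
      have "(\<lambda>x. x * sinv t) ` T \<subseteq> down UNIV (u * sinv t)"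
        using T(2) by (rule image_down) (simp add: nat_le_mult)
      then show "openin (prod_topology ?P ?P)
          (patch_basic UNIV (u * sinv t) ((\<lambda>x. x * sinv t) ` T) \<times> patch_basic UNIV t {})"
        using T(1) by (simp add: openin_prod_Times_iff openin_patch_basic)
    qed
    then have "openin (subtopology (prod_topology ?P ?P) ?C) (W \<inter> ?C)"
      by (rule openin_subtopology_Int)
    also have "W \<inter> ?C = (\<lambda>(F, G). filter_mult F G) -` patch_basic UNIV u T
        \<inter> topspace (subtopology (prod_topology ?P ?P) ?C)"
    proof -
      have "(F, G) \<in> W \<longleftrightarrow> filter_mult F G \<in> patch_basic UNIV u T" if FG: "(F, G) \<in> ?C" for F G
      proof -
        have F: "F \<in> proper_filters UNIV" and G: "G \<in> proper_filters UNIV"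
          and "filter_mult F G \<in> proper_filters UNIV"
          using FG by (auto simp: composable_filter_groupoid filter_mult_proper)
        then have "F \<in> patch_basic UNIV (u * sinv t) ((\<lambda>x. x * sinv t) ` T) \<longleftrightarrow>
            filter_mult F G \<in> patch_basic UNIV u T" if "t \<in> G" for t
          unfolding patch_basic_def using that by (auto simp: mem_filter_mult_iff[OF FG] subset_iff)
        moreover have "G \<in> patch_basic UNIV t {} \<longleftrightarrow> t \<in> G" for t
          using G by (simp add: patch_basic_def)
        ultimately have "(F, G) \<in> W \<longleftrightarrow> (\<exists>t\<in>G. filter_mult F G \<in> patch_basic UNIV u T)"
          unfolding W_def by blast
        \<comment> \<open>The condition on the product filter does not involve t, so nonemptiness of
          G removes the quantifier.\<close>
        then show ?thesis
          using proper_filtersD(1)[OF G] unfolding is_filter_iff by blast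
      qed
      then show ?thesis
        using C by auto
    qed
    finally show "openin (subtopology (prod_topology ?P ?P) ?C)
        ((\<lambda>(F, G). filter_mult F G) -` patch_basic UNIV u T
          \<inter> topspace (subtopology (prod_topology ?P ?P) ?C))" .
  qed
  show "continuous_map ?P ?P set_sinv"
  proof (rule continuous_map_patch_topology)
    fix s :: 'a and T
    assume T: "finite T" "T \<subseteq> down UNIV s"
    have "openin ?P (patch_basic UNIV (sinv s) (sinv ` T))"
      using T image_down[OF T(2), where f = sinv, OF nat_le_sinv] by (simp add: openin_patch_basic)
    also have "patch_basic UNIV (sinv s) (sinv ` T) = set_sinv -` patch_basic UNIV s T \<inter> topspace ?P"
    proof -
      have "F \<subseteq> UNIV - sinv ` T \<longleftrightarrow> set_sinv F \<subseteq> UNIV - T" for F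
      proof -
        have "F \<subseteq> UNIV - sinv ` T \<longleftrightarrow> (\<forall>x\<in>T. sinv x \<notin> F)" by blast
        also have "\<dots> \<longleftrightarrow> set_sinv F \<subseteq> UNIV - T"
          using set_sinv_iff[of _ F] by blast
        finally show ?thesis .
      qed
      then show ?thesis
        by (auto simp: patch_basic_def set_sinv_iff set_sinv_proper)
    qed
    finally show "openin ?P (set_sinv -` patch_basic UNIV s T \<inter> topspace ?P)" .
  qed (auto simp: set_sinv_proper)
qed


text \<open>One direction is the recovery of F from s and xi_F. For the other, the source of
  \<open>s * e\<close> is \<open>e * (sinv s * s) * e\<close>, which lies below e.\<close>

lemma mem_filter_idem_iff:
  assumes F: "is_filter UNIV F" and s: "s \<in> F" and e: "e \<in> idempotents"
  shows "e \<in> filter_idem F \<longleftrightarrow> s * e \<in> F"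
proof
  assume "e \<in> filter_idem F"
  then have "s * e \<in> germ_filter s (filter_idem F)"
    using nat_le_refl by (rule germ_filterI)
  then show "s * e \<in> F"
    by (simp add: germ_filter_filter_idem[OF F s])
next
  assume "s * e \<in> F"
  moreover have "e * (sinv s * s) * e \<preceq> e"
    by (rule idempotent_mult_nat_le, rule idempotent_mult) (simp_all add: e)
  then have "sinv (s * e) * (s * e) \<preceq> e"
    using e by (simp add: sinv_mult sinv_idempotent mult.assoc)
  ultimately show "e \<in> filter_idem F"
    using e by (auto simp: filter_idem_iff[OF F])
qed

lemma continuous_map_filter_idem:
  "continuous_map (patch_topology UNIV) (patch_topology idempotents) filter_idem"
proof (rule continuous_map_patch_topology)
  let ?P = "patch_topology (UNIV :: 'a set)"
  show "filter_idem \<in> topspace ?P \<rightarrow> proper_filters idempotents"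
    by (simp add: filter_idem_proper)
  fix e :: 'a and X
  assume e: "e \<in> idempotents" and X: "finite X" "X \<subseteq> down idempotents e"
  \<comment> \<open>For s in F, left multiplication by s turns conditions on xi_F into conditions on
    F. No single s serves all filters, hence the union.\<close>
  have "openin ?P (\<Union>s. patch_basic UNIV (s * e) ((*) s ` X))"
  proof (rule openin_Union, clarify)
    fix s
    have "X \<subseteq> down UNIV e"
      using X(2) by (auto simp: down_def)
    then have "(*) s ` X \<subseteq> down UNIV (s * e)"
      by (rule image_down) (simp add: nat_le_mult)
    then show "openin ?P (patch_basic UNIV (s * e) ((*) s ` X))"
      using X(1) by (simp add: openin_patch_basic)
  qed
  also have "(\<Union>s. patch_basic UNIV (s * e) ((*) s ` X))
      = filter_idem -` patch_basic idempotents e X \<inter> topspace ?P"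
  proof -
    have "(\<exists>s. F \<in> patch_basic UNIV (s * e) ((*) s ` X)) \<longleftrightarrow> filter_idem F \<in> patch_basic idempotents e X"
      if F: "F \<in> proper_filters UNIV" for F
    proof -
      note F' = proper_filtersD(1)[OF F]
      \<comment> \<open>The union is over arbitrary s, but F can lie only in members with s in F,
        because \<open>s * e\<close> is below s; so the membership test is always available.\<close>
      have s: "s \<in> F" if "s * e \<in> F" for s
        using filter_up[OF F' that] mult_idempotent_nat_le[OF e] by blast
      have sub: "filter_idem F \<subseteq> idempotents" "X \<subseteq> idempotents"
        using X(2) filter_idem_iff[OF F'] by (auto simp: down_def)
      have "F \<in> patch_basic UNIV (s * e) ((*) s ` X) \<longleftrightarrow> filter_idem F \<in> patch_basic idempotents e X"
        if "s \<in> F" for s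
      proof -
        have "F \<subseteq> UNIV - (*) s ` X \<longleftrightarrow> (\<forall>x\<in>X. s * x \<notin> F)" by blast
        also have "\<dots> \<longleftrightarrow> (\<forall>x\<in>X. x \<notin> filter_idem F)"
        proof (rule ball_cong[OF refl])
          fix x
          assume "x \<in> X"
          then have "x \<in> idempotents"
            using sub(2) by blast
          then show "s * x \<notin> F \<longleftrightarrow> x \<notin> filter_idem F"
            by (simp add: mem_filter_idem_iff[OF F' that])
        qed
        also have "\<dots> \<longleftrightarrow> filter_idem F \<subseteq> idempotents - X"
          using sub(1) by blast
        finally show ?thesis
          using F filter_idem_proper[OF F] mem_filter_idem_iff[OF F' that e]
          by (simp add: patch_basic_def)
      qed
      moreover have "\<exists>s. s \<in> F"
        using F' unfolding is_filter_iff by blast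
      moreover have "s \<in> F" if "F \<in> patch_basic UNIV (s * e) ((*) s ` X)" for s
        using s that by (simp add: patch_basic_def)
      ultimately show ?thesis by blast
    qed
    moreover have "F \<in> proper_filters UNIV" if "F \<in> patch_basic UNIV s T" for F s and T :: "'a set"
      using that by (simp add: patch_basic_def)
    ultimately show ?thesis
      by (intro set_eqI) (simp only: topspace_patch_topology UN_iff Int_iff vimage_eq, blast)
  qed
  finally show "openin ?P (filter_idem -` patch_basic idempotents e X \<inter> topspace ?P)" .
qed

section \<open>The topology on germs and the homeomorphism\<close>

lemma openin_Theta:
  "A \<subseteq> FE (sinv s * s) \<Longrightarrow> openin (patch_topology idempotents) A \<Longrightarrow> openin germ_topology (Theta s A)"
  unfolding germ_topology_def by (rule topology_generated_by_Basis) blast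

lemma patch_basic_idempotents_subset: "patch_basic idempotents e X \<subseteq> FE e"
  by (auto simp: patch_basic_def FE_def)

text \<open>A germ has a representative with first component s exactly when its filter contains s. A
  generator of the germ topology therefore pulls back to two open conditions on F, and both
  directions of the homeomorphism use this.\<close>

lemma germ_map_mem_Theta_iff:
  assumes F: "F \<in> proper_filters UNIV" and A: "A \<subseteq> FE (sinv s * s)"
  shows "germ_map F \<in> Theta s A \<longleftrightarrow> s \<in> F \<and> filter_idem F \<in> A"
proof
  assume "germ_map F \<in> Theta s A"
  then obtain \<xi> where \<xi>: "germ_map F = germ s \<xi>" "\<xi> \<in> A"
    by (auto simp: Theta_def)
  then have s: "(s, \<xi>) \<in> germ_pairs"
    using A by (auto simp: germ_pairs_def)
  then have "F = germ_filter s \<xi>"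
    using \<xi>(1) germ_map_eq_germ_iff[OF F] by blast
  then show "s \<in> F \<and> filter_idem F \<in> A"
    using \<xi>(2) mem_germ_filter[OF s] filter_idem_germ_filter[OF s] by simp
next
  assume "s \<in> F \<and> filter_idem F \<in> A"
  then show "germ_map F \<in> Theta s A"
    using germ_map_eq[OF F] by (auto simp: Theta_def)
qed

lemma Theta_subset:
  assumes "A \<subseteq> FE (sinv s * s)"
  shows "Theta s A \<subseteq> germ_map ` proper_filters UNIV"
proof
  fix g
  assume "g \<in> Theta s A"
  then obtain \<xi> where "g = germ s \<xi>" "(s, \<xi>) \<in> germ_pairs"
    using assms by (auto simp: Theta_def germ_pairs_def)
  then show "g \<in> germ_map ` proper_filters UNIV"
    using germ_map_germ_filter[symmetric] germ_filter_proper by blast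
qed

lemma topspace_germ_topology:
  "topspace (germ_topology :: 'a::inverse_semigroup_zero germ topology) = germ_map ` proper_filters UNIV"
  (is "?X = ?Y")
proof
  show "?X \<subseteq> ?Y"
    unfolding germ_topology_def topology_generated_by_topspace using Theta_subset by blast
  show "?Y \<subseteq> ?X"
  proof clarify
    fix F :: "'a set"
    assume F: "F \<in> proper_filters UNIV"
    obtain s where s: "s \<in> F"
      using filter_nonempty[OF proper_filtersD(1)[OF F]] .
    let ?A = "patch_basic idempotents (sinv s * s) {}"
    have "filter_idem F \<in> ?A"
      using filter_idem_proper[OF F] sinv_mult_mem_filter_idem[OF proper_filtersD(1)[OF F] s]
        proper_filtersD(1)[OF filter_idem_proper[OF F]]
      by (auto simp: patch_basic_def is_filter_iff[of idempotents])
    then have "germ_map F \<in> Theta s ?A"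
      using s germ_map_mem_Theta_iff[OF F patch_basic_idempotents_subset] by simp
    moreover have "openin germ_topology (Theta s ?A)"
      by (intro openin_Theta patch_basic_idempotents_subset openin_patch_basic) simp_all
    ultimately show "germ_map F \<in> topspace germ_topology"
      using openin_subset by blast
  qed
qed

lemma continuous_map_germ_map: "continuous_map (patch_topology UNIV) germ_topology germ_map"
  unfolding germ_topology_def
proof (rule continuous_on_generated_topo, clarify)
  let ?P = "patch_topology (UNIV :: 'a set)"
  show "germ_map ` topspace ?P \<subseteq>
      \<Union> {Theta s A | s A. A \<subseteq> FE (sinv s * s) \<and> openin (patch_topology idempotents) A}"
    using topspace_germ_topology[where 'a = 'a] by (simp add: germ_topology_def)
  fix s :: 'a and A
  assume A: "A \<subseteq> FE (sinv s * s)" "openin (patch_topology idempotents) A"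
  have "openin ?P {F \<in> topspace ?P. filter_idem F \<in> A}"
    using openin_continuous_map_preimage[OF continuous_map_filter_idem A(2)] .
  then have "openin ?P (patch_basic UNIV s {} \<inter> {F \<in> topspace ?P. filter_idem F \<in> A})"
    by (intro openin_Int openin_patch_basic) simp_all
  also have "patch_basic UNIV s {} \<inter> {F \<in> topspace ?P. filter_idem F \<in> A}
      = germ_map -` Theta s A \<inter> topspace ?P"
    using germ_map_mem_Theta_iff[OF _ A(1)] by (auto simp: patch_basic_def)
  finally show "openin ?P (germ_map -` Theta s A \<inter> topspace ?P)" .
qed

text \<open>Each excluded t lies below s, so \<open>t = s * (sinv t * t)\<close> and the membership
  test for xi_F applies with the idempotent \<open>sinv t * t\<close>. This is where it matters that
  exclusions lie below s.\<close>

lemma germ_map_image_patch_basic: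
  assumes T: "T \<subseteq> down UNIV s"
  shows "germ_map ` patch_basic UNIV s T
    = Theta s (patch_basic idempotents (sinv s * s) ((\<lambda>t. sinv t * t) ` T))"
    (is "_ = Theta s ?A")
proof -
  have "F \<in> patch_basic UNIV s T \<longleftrightarrow> s \<in> F \<and> filter_idem F \<in> ?A"
    if F: "F \<in> proper_filters UNIV" for F
  proof -
    note F' = proper_filtersD(1)[OF F]
    have "t \<in> F \<longleftrightarrow> sinv t * t \<in> filter_idem F" if "t \<in> T" "s \<in> F" for t
      using mem_filter_idem_iff[OF F' that(2), of "sinv t * t"] nat_le_right[of t s] T that(1)
      by (auto simp: down_def)
    moreover have "filter_idem F \<subseteq> idempotents"
      using filter_idem_iff[OF F'] by blast
    ultimately show ?thesis
      using F filter_idem_proper[OF F] sinv_mult_mem_filter_idem[OF F']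
      unfolding patch_basic_def by blast
  qed
  then have "F \<in> patch_basic UNIV s T \<longleftrightarrow> germ_map F \<in> Theta s ?A" if "F \<in> proper_filters UNIV" for F
    using germ_map_mem_Theta_iff[OF that patch_basic_idempotents_subset] that by blast
  moreover have "Theta s ?A \<subseteq> germ_map ` proper_filters UNIV"
    by (rule Theta_subset[OF patch_basic_idempotents_subset])
  moreover have "patch_basic UNIV s T \<subseteq> proper_filters UNIV"
    by (auto simp: patch_basic_def)
  ultimately show ?thesis by blast
qed

lemma homeomorphic_map_germ_map: "homeomorphic_map (patch_topology UNIV) germ_topology germ_map"
proof -
  let ?P = "patch_topology (UNIV :: 'a set)"
  let ?\<psi> = "inv_into (proper_filters UNIV) (germ_map :: 'a set \<Rightarrow> 'a germ)"
  have \<psi>: "?\<psi> (germ_map F) = F" if "F \<in> proper_filters UNIV" for F :: "'a set"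
    using inv_into_f_f[OF inj_on_germ_map that] .
  have "continuous_map germ_topology ?P ?\<psi>"
  proof (rule continuous_map_patch_topology)
    show "?\<psi> \<in> topspace germ_topology \<rightarrow> proper_filters UNIV"
      by (auto simp: topspace_germ_topology \<psi>)
    fix s :: 'a and T
    assume T: "finite T" "T \<subseteq> down UNIV s"
    have "(\<lambda>t. sinv t * t) ` T \<subseteq> down idempotents (sinv s * s)"
      using T(2) nat_le_sinv_mult by (auto simp: down_def)
    then have "openin germ_topology (germ_map ` patch_basic UNIV s T)"
      unfolding germ_map_image_patch_basic[OF T(2)] using T(1)
      by (intro openin_Theta patch_basic_idempotents_subset openin_patch_basic) simp_all
    \<comment> \<open>By injectivity on proper filters, the preimage under the inverse map is the
      image under \<open>germ_map\<close>.\<close>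
    also have "germ_map ` patch_basic UNIV s T = ?\<psi> -` patch_basic UNIV s T \<inter> topspace germ_topology"
    proof -
      have "patch_basic UNIV s T \<subseteq> proper_filters UNIV"
        by (auto simp: patch_basic_def)
      then show ?thesis
        using \<psi> by (auto simp: topspace_germ_topology)
    qed
    finally show "openin germ_topology (?\<psi> -` patch_basic UNIV s T \<inter> topspace germ_topology)" .
  qed
  then have "homeomorphic_maps ?P germ_topology germ_map ?\<psi>"
    using continuous_map_germ_map \<psi> by (auto simp: homeomorphic_maps_def topspace_germ_topology)
  then show ?thesis
    by (rule homeomorphic_maps_imp_map)
qed


section \<open>Restriction and transport of topological groupoids\<close>

lemma is_groupoidD:
  assumes "is_groupoid G"
  shows "(x, y) \<in> composable G \<Longrightarrow> x \<in> arrows G \<and> y \<in> arrows G"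
    and "(x, y) \<in> composable G \<Longrightarrow> gcomp G x y \<in> arrows G"
    and "x \<in> arrows G \<Longrightarrow> ginv G x \<in> arrows G"
    and "(x, y) \<in> composable G \<Longrightarrow> (y, z) \<in> composable G \<Longrightarrow>
      (gcomp G x y, z) \<in> composable G \<and> (x, gcomp G y z) \<in> composable G \<and>
      gcomp G (gcomp G x y) z = gcomp G x (gcomp G y z)"
    and "x \<in> arrows G \<Longrightarrow> ginv G (ginv G x) = x \<and>
      (x, ginv G x) \<in> composable G \<and> (ginv G x, x) \<in> composable G"
    and "(x, y) \<in> composable G \<Longrightarrow> gcomp G (ginv G x) (gcomp G x y) = y \<and>
      gcomp G (gcomp G x y) (ginv G y) = x"
proof -
  note G = assms[unfolded is_groupoid_def]
  note G1 = conjunct1[OF G] note G = conjunct2[OF G]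
  note G2 = conjunct1[OF G] note G = conjunct2[OF G]
  note G3 = conjunct1[OF G] note G = conjunct2[OF G]
  note G4 = conjunct1[OF G] note G = conjunct2[OF G]
  note G5 = conjunct1[OF G] and G6 = conjunct2[OF G]
  show "(x, y) \<in> composable G \<Longrightarrow> x \<in> arrows G \<and> y \<in> arrows G"
    using G1 by auto
  show "(x, y) \<in> composable G \<Longrightarrow> gcomp G x y \<in> arrows G"
    using G2 by auto
  show "x \<in> arrows G \<Longrightarrow> ginv G x \<in> arrows G"
    using G3 by auto
  show "(x, y) \<in> composable G \<Longrightarrow> (y, z) \<in> composable G \<Longrightarrow>
      (gcomp G x y, z) \<in> composable G \<and> (x, gcomp G y z) \<in> composable G \<and>
      gcomp G (gcomp G x y) z = gcomp G x (gcomp G y z)"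
    using G4 by auto
  show "x \<in> arrows G \<Longrightarrow> ginv G (ginv G x) = x \<and>
      (x, ginv G x) \<in> composable G \<and> (ginv G x, x) \<in> composable G"
    using G5 by auto
  show "(x, y) \<in> composable G \<Longrightarrow> gcomp G (ginv G x) (gcomp G x y) = y \<and>
      gcomp G (gcomp G x y) (ginv G y) = x"
    using G6 by auto
qed

lemma is_groupoidI:
  assumes "\<And>x y. (x, y) \<in> composable G \<Longrightarrow> x \<in> arrows G \<and> y \<in> arrows G"
    and "\<And>x y. (x, y) \<in> composable G \<Longrightarrow> gcomp G x y \<in> arrows G"
    and "\<And>x. x \<in> arrows G \<Longrightarrow> ginv G x \<in> arrows G"
    and "\<And>x y z. (x, y) \<in> composable G \<Longrightarrow> (y, z) \<in> composable G \<Longrightarrow>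
      (gcomp G x y, z) \<in> composable G \<and> (x, gcomp G y z) \<in> composable G \<and>
      gcomp G (gcomp G x y) z = gcomp G x (gcomp G y z)"
    and "\<And>x. x \<in> arrows G \<Longrightarrow> ginv G (ginv G x) = x \<and>
      (x, ginv G x) \<in> composable G \<and> (ginv G x, x) \<in> composable G"
    and "\<And>x y. (x, y) \<in> composable G \<Longrightarrow> gcomp G (ginv G x) (gcomp G x y) = y \<and>
      gcomp G (gcomp G x y) (ginv G y) = x"
  shows "is_groupoid G"
  unfolding is_groupoid_def
proof (intro conjI)
  show "composable G \<subseteq> arrows G \<times> arrows G"
    using assms(1) by auto
  show "\<forall>(x, y)\<in>composable G. gcomp G x y \<in> arrows G"
    using assms(2) by auto
  show "\<forall>x\<in>arrows G. ginv G x \<in> arrows G"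
    using assms(3) by auto
  show "\<forall>x y z. (x, y) \<in> composable G \<longrightarrow> (y, z) \<in> composable G \<longrightarrow>
      (gcomp G x y, z) \<in> composable G \<and> (x, gcomp G y z) \<in> composable G \<and>
      gcomp G (gcomp G x y) z = gcomp G x (gcomp G y z)"
    using assms(4) by auto
  show "\<forall>x\<in>arrows G. ginv G (ginv G x) = x \<and>
      (x, ginv G x) \<in> composable G \<and> (ginv G x, x) \<in> composable G"
    using assms(5) by auto
  show "\<forall>(x, y)\<in>composable G. gcomp G (ginv G x) (gcomp G x y) = y \<and>
      gcomp G (gcomp G x y) (ginv G y) = x"
    using assms(6) by auto
qed

lemma restrict_groupoid_simps [simp]:
  "arrows (restrict_groupoid G A) = arrows G \<inter> A"
  "composable (restrict_groupoid G A) = composable G \<inter> A \<times> A"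
  "gcomp (restrict_groupoid G A) = gcomp G"
  "ginv (restrict_groupoid G A) = ginv G"
  by (simp_all add: restrict_groupoid_def)

lemma topological_groupoid_restrict:
  assumes G: "topological_groupoid G X"
    and mult: "\<And>x y. (x, y) \<in> composable G \<Longrightarrow> x \<in> A \<Longrightarrow> y \<in> A \<Longrightarrow> gcomp G x y \<in> A"
    and inv: "\<And>x. x \<in> arrows G \<Longrightarrow> x \<in> A \<Longrightarrow> ginv G x \<in> A"
  shows "topological_groupoid (restrict_groupoid G A) (subtopology X A)"
  unfolding topological_groupoid_def restrict_groupoid_simps
proof (intro conjI)
  have gr: "is_groupoid G" and X: "topspace X = arrows G"
    and m: "continuous_map (subtopology (prod_topology X X) (composable G)) X (\<lambda>(x, y). gcomp G x y)"
    and i: "continuous_map X X (ginv G)"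
    using G by (simp_all add: topological_groupoid_def)
  note D = is_groupoidD[OF gr]
  show "is_groupoid (restrict_groupoid G A)"
  proof (rule is_groupoidI; unfold restrict_groupoid_simps)
    fix x y z
    assume xy: "(x, y) \<in> composable G \<inter> A \<times> A"
    show "x \<in> arrows G \<inter> A \<and> y \<in> arrows G \<inter> A"
      using xy D(1) by blast
    show "gcomp G x y \<in> arrows G \<inter> A"
      using xy D(2) mult by blast
    show "gcomp G (ginv G x) (gcomp G x y) = y \<and> gcomp G (gcomp G x y) (ginv G y) = x"
      using xy D(6) by blast
    assume yz: "(y, z) \<in> composable G \<inter> A \<times> A"
    show "(gcomp G x y, z) \<in> composable G \<inter> A \<times> A \<and> (x, gcomp G y z) \<in> composable G \<inter> A \<times> A \<and>
        gcomp G (gcomp G x y) z = gcomp G x (gcomp G y z)"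
      using xy yz D(4)[of x y z] mult by blast
  next
    fix x
    assume x: "x \<in> arrows G \<inter> A"
    show "ginv G x \<in> arrows G \<inter> A"
      using x D(3) inv by blast
    show "ginv G (ginv G x) = x \<and> (x, ginv G x) \<in> composable G \<inter> A \<times> A \<and>
        (ginv G x, x) \<in> composable G \<inter> A \<times> A"
      using x D(5)[of x] inv by blast
  qed
  show "topspace (subtopology X A) = arrows G \<inter> A"
    using X by simp
  \<comment> \<open>The product of subspaces is a subspace of the product, so the restricted
    multiplication is the old one on a smaller domain.\<close>
  have eq: "subtopology (prod_topology (subtopology X A) (subtopology X A)) (composable G \<inter> A \<times> A)
      = subtopology (subtopology (prod_topology X X) (composable G)) (A \<times> A)"
    by (simp add: subtopology_Times[symmetric] subtopology_subtopology Int_ac)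
  show "continuous_map
      (subtopology (prod_topology (subtopology X A) (subtopology X A)) (composable G \<inter> A \<times> A))
      (subtopology X A) (\<lambda>(x, y). gcomp G x y)"
    unfolding eq
  proof (rule continuous_map_into_subtopology[OF continuous_map_from_subtopology[OF m]], rule funcsetI)
    fix p
    assume "p \<in> topspace (subtopology (subtopology (prod_topology X X) (composable G)) (A \<times> A))"
    then show "(\<lambda>(x, y). gcomp G x y) p \<in> A"
      using mult by (cases p) simp
  qed
  show "continuous_map (subtopology X A) (subtopology X A) (ginv G)"
    by (rule continuous_map_into_subtopology[OF continuous_map_from_subtopology[OF i]])
      (use inv X in auto)
qed

text \<open>That \<open>H\<close> is a topological groupoid is a conclusion: its arrows and
  composable pairs are exactly images of those of \<open>G\<close>, so each law is checked on lifts,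
  and its operations are conjugates of continuous ones.\<close>

lemma topological_groupoid_isomorphism_transport:
  assumes G: "topological_groupoid G X"
    and hom: "homeomorphic_map X Y \<phi>"
    and arr: "arrows H = \<phi> ` arrows G"
    and comp: "composable H = map_prod \<phi> \<phi> ` composable G"
    and mult: "\<And>x y. (x, y) \<in> composable G \<Longrightarrow> gcomp H (\<phi> x) (\<phi> y) = \<phi> (gcomp G x y)"
    and inv: "\<And>x. x \<in> arrows G \<Longrightarrow> ginv H (\<phi> x) = \<phi> (ginv G x)"
  shows "topological_groupoid_isomorphism G X H Y \<phi>"
proof -
  have gr: "is_groupoid G" and X: "topspace X = arrows G"
    and m: "continuous_map (subtopology (prod_topology X X) (composable G)) X (\<lambda>(x, y). gcomp G x y)"
    and i: "continuous_map X X (ginv G)"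
    using G by (simp_all add: topological_groupoid_def)
  note D = is_groupoidD[OF gr]
  have inj: "inj_on \<phi> (arrows G)" and Y: "topspace Y = arrows H"
    using homeomorphic_imp_injective_map[OF hom] homeomorphic_imp_surjective_map[OF hom] X arr
    by simp_all
  obtain \<psi> where \<psi>: "homeomorphic_maps X Y \<phi> \<psi>"
    using hom by (auto simp: homeomorphic_map_maps)
  then have c\<phi>: "continuous_map X Y \<phi>" and c\<psi>: "continuous_map Y X \<psi>"
    and \<psi>\<phi>: "\<And>x. x \<in> arrows G \<Longrightarrow> \<psi> (\<phi> x) = x"
    using X by (auto simp: homeomorphic_maps_def)
  have compE: "\<exists>x y. a = \<phi> x \<and> b = \<phi> y \<and> (x, y) \<in> composable G" if "(a, b) \<in> composable H" for a b
    using that comp by auto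
  have compI: "(\<phi> x, \<phi> y) \<in> composable H" if "(x, y) \<in> composable G" for x y
    using that comp by force
  have "is_groupoid H"
  proof (rule is_groupoidI)
    fix a b
    assume "(a, b) \<in> composable H"
    then obtain x y where ab: "a = \<phi> x" "b = \<phi> y" and xy: "(x, y) \<in> composable G"
      using compE by blast
    note x = D(1)[OF xy]
    show "a \<in> arrows H \<and> b \<in> arrows H" "gcomp H a b \<in> arrows H"
      using ab x D(2)[OF xy] by (simp_all add: arr mult[OF xy])
    \<comment> \<open>The compatibility of \<phi> with products is assumed only for composable
      pairs, so composability of these is secured before cancelling.\<close>
    have "(ginv G x, gcomp G x y) \<in> composable G" "(gcomp G x y, ginv G y) \<in> composable G"
      using D(4)[OF conjunct2[OF conjunct2[OF D(5)]] xy] D(4)[OF xy conjunct1[OF conjunct2[OF D(5)]]] x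
      by blast+
    then show "gcomp H (ginv H a) (gcomp H a b) = b \<and> gcomp H (gcomp H a b) (ginv H b) = a"
      using ab x D(6)[OF xy] by (simp add: mult xy inv)
    fix c
    assume "(b, c) \<in> composable H"
    then obtain y' z where b': "b = \<phi> y'" "c = \<phi> z" and yz': "(y', z) \<in> composable G"
      using compE by blast
    \<comment> \<open>The two composable pairs lift separately; injectivity makes the lifts of their
      common entry agree.\<close>
    then have "y' = y"
      using inj_onD[OF inj] ab(2) x D(1)[OF yz'] by metis
    then have yz: "(y, z) \<in> composable G"
      using yz' by simp
    show "(gcomp H a b, c) \<in> composable H \<and> (a, gcomp H b c) \<in> composable H \<and>
        gcomp H (gcomp H a b) c = gcomp H a (gcomp H b c)"
      using ab b' D(4)[OF xy yz] by (simp add: mult xy yz compI)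
  next
    fix a
    assume "a \<in> arrows H"
    then obtain x where x: "a = \<phi> x" "x \<in> arrows G"
      using arr by auto
    then show "ginv H a \<in> arrows H"
      "ginv H (ginv H a) = a \<and> (a, ginv H a) \<in> composable H \<and> (ginv H a, a) \<in> composable H"
      using D(3,5)[OF x(2)] by (simp_all add: inv arr compI)
  qed
  moreover have "continuous_map (subtopology (prod_topology Y Y) (composable H)) Y (\<lambda>(a, b). gcomp H a b)"
  proof -
    \<comment> \<open>Multiplication on \<open>H\<close> is obtained by pulling both factors back
      along \<psi>, multiplying in \<open>G\<close> and applying \<phi>.\<close>
    have "continuous_map (prod_topology Y Y) (prod_topology X X) (\<lambda>(a, b). (\<psi> a, \<psi> b))"
      using c\<psi> by (simp add: continuous_map_prod_top)
    then have "continuous_map (subtopology (prod_topology Y Y) (composable H))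
        (subtopology (prod_topology X X) (composable G)) (\<lambda>(a, b). (\<psi> a, \<psi> b))"
      using D(1) by (intro continuous_map_into_subtopology continuous_map_from_subtopology)
        (auto simp: comp \<psi>\<phi>)
    from continuous_map_compose[OF this continuous_map_compose[OF m c\<phi>]]
    show ?thesis
    proof (rule continuous_map_eq)
      fix p
      assume "p \<in> topspace (subtopology (prod_topology Y Y) (composable H))"
      then obtain x y where "p = (\<phi> x, \<phi> y)" and xy: "(x, y) \<in> composable G"
        using comp by auto
      then show "(\<phi> \<circ> (\<lambda>(x, y). gcomp G x y) \<circ> (\<lambda>(a, b). (\<psi> a, \<psi> b))) p = (\<lambda>(a, b). gcomp H a b) p"
        using D(1)[OF xy] by (simp add: \<psi>\<phi> mult[OF xy])
    qed
  qed
  moreover have "continuous_map Y Y (ginv H)"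
    using continuous_map_compose[OF c\<psi> continuous_map_compose[OF i c\<phi>]]
    by (rule continuous_map_eq) (auto simp: Y arr inv \<psi>\<phi>)
  moreover have "groupoid_isomorphism G H \<phi>"
    using inj arr mult compI by (auto simp: groupoid_isomorphism_def bij_betw_def)
  ultimately show ?thesis
    using G hom Y by (simp add: topological_groupoid_isomorphism_def topological_groupoid_def)
qed

text \<open>The filter groupoid is restricted before transport, so closure under product and inverse
  is verified for ultrafilters only; ultragerms enter as their image.\<close>

theorem corollary4p3:
  "topological_groupoid_isomorphism
     ultrafilter_groupoid ultrafilter_topology
     ultragerm_groupoid ultragerm_topology
     (restrict (germ_map :: 'a::inverse_semigroup_zero set \<Rightarrow> 'a germ) (ultrafilters UNIV))"
proof (rule topological_groupoid_isomorphism_transport)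
  let ?U = "ultrafilters (UNIV :: 'a set)"
  let ?C = "composable (filter_groupoid :: 'a set groupoid_data)"
  have U: "?U \<subseteq> proper_filters UNIV"
    by (rule ultrafilters_subset)
  show "topological_groupoid ultrafilter_groupoid (ultrafilter_topology :: 'a set topology)"
    unfolding ultrafilter_groupoid_def ultrafilter_topology_def
    by (intro topological_groupoid_restrict topological_groupoid_filter_groupoid)
      (simp_all add: filter_mult_ultrafilter set_sinv_ultrafilter)
  have top: "topspace (ultrafilter_topology :: 'a set topology) = ?U"
    using U by (auto simp: ultrafilter_topology_def)
  have "homeomorphic_map ultrafilter_topology ultragerm_topology (germ_map :: 'a set \<Rightarrow> 'a germ)"
    unfolding ultrafilter_topology_def ultragerm_topology_def
  proof (rule homeomorphic_map_subtopologies[OF homeomorphic_map_germ_map])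
    show "germ_map ` (topspace (patch_topology UNIV) \<inter> ?U) = topspace germ_topology \<inter> ultragerms"
      using U by (auto simp: topspace_germ_topology ultragerms_eq)
  qed
  \<comment> \<open>\<open>restrict\<close> changes values only off the ultrafilters, hence only
    outside the space.\<close>
  then show "homeomorphic_map ultrafilter_topology ultragerm_topology (restrict germ_map ?U)"
    by (rule homeomorphic_map_eq) (simp add: top)
  show "arrows ultragerm_groupoid = restrict germ_map ?U ` arrows ultrafilter_groupoid"
    using U by (auto simp: ultragerm_groupoid_def ultrafilter_groupoid_def ultragerms_eq
        germ_map_image[symmetric])
  \<comment> \<open>Injectivity on all proper filters ensures that only ultrafilters map to
    ultragerms, so a composable pair of ultragerms lifts to a pair of ultrafilters.\<close>
  have mem: "germ_map F \<in> ultragerms \<longleftrightarrow> F \<in> ?U" if "F \<in> proper_filters UNIV" for F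
    unfolding ultragerms_eq using inj_on_image_mem_iff[OF inj_on_germ_map that U] .
  show "composable ultragerm_groupoid =
      map_prod (restrict germ_map ?U) (restrict germ_map ?U) ` composable ultrafilter_groupoid"
  proof -
    have C: "?C \<subseteq> proper_filters UNIV \<times> proper_filters UNIV"
      by (auto simp: composable_filter_groupoid)
    have "composable ultragerm_groupoid = map_prod germ_map germ_map ` ?C \<inter> ultragerms \<times> ultragerms"
      by (simp add: ultragerm_groupoid_def composable_germ_groupoid)
    also have "\<dots> = map_prod germ_map germ_map ` (?C \<inter> ?U \<times> ?U)"
      using C mem by force
    also have "\<dots> = map_prod (restrict germ_map ?U) (restrict germ_map ?U) ` (?C \<inter> ?U \<times> ?U)"
      by (rule image_cong) auto
    finally show ?thesis
      by (simp add: ultrafilter_groupoid_def)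
  qed
  fix F G :: "'a set"
  { assume "(F, G) \<in> composable ultrafilter_groupoid"
    then have *: "(F, G) \<in> ?C" "F \<in> ?U" "G \<in> ?U"
      by (simp_all add: ultrafilter_groupoid_def)
    then show "gcomp ultragerm_groupoid (restrict germ_map ?U F) (restrict germ_map ?U G) =
        restrict germ_map ?U (gcomp ultrafilter_groupoid F G)"
      using germ_mult_germ_map[OF *(1)] filter_mult_ultrafilter[OF *(1,3)]
      by (simp add: ultrafilter_groupoid_def ultragerm_groupoid_def germ_groupoid_def) }
  assume "F \<in> arrows ultrafilter_groupoid"
  then have "F \<in> ?U" "F \<in> proper_filters UNIV"
    by (auto simp: ultrafilter_groupoid_def)
  then show "ginv ultragerm_groupoid (restrict germ_map ?U F) =
      restrict germ_map ?U (ginv ultrafilter_groupoid F)"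
    using germ_inv_germ_map[of F] set_sinv_ultrafilter[of F]
    by (simp add: ultrafilter_groupoid_def ultragerm_groupoid_def germ_groupoid_def)
qed

end
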